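(* Let $u$ be the single-agent value function and $a^{\ast}=-\dfrac{bu_x+u_{xy}}{u_{xx}}$ its optimal feedback control (see context), and let $C:\mathcal{P}_2\to\mathbb{R}$, $C>0$, be a coupling function. Assume that the problem $$f_t+\mathcal{L}_2f+\mathcal{L}_4f+\frac12f_{yy}=0\ \text{ in }\mathbb{R}\times\mathcal{P}_2\times[0,T),\qquad f(y,m,T)=C(m),$$ admits a smooth solution $f:\mathbb{R}\times\mathcal{P}_2\times[0,T]\to\mathbb{R}$, with $\pi^{\ast}:\mathbb{R}\times\mathbb{R}\times\mathcal{P}_2\times[0,T]\to\mathbb{R}$ satisfying, for each $(x,y,m,t)\in\mathbb{R}\times\mathbb{R}\times\mathcal{P}_2\times[0,T]$, $$\pi^{\ast}(x,y,m,t)-\int\pi^{\ast}(z,y,m,t)f_m(y,m,z,t)\,dm(z)=f_y(y,m,t)+a^{\ast}(x-f(y,m,t),y,t).$$ Then, with this $\pi^{\ast}$, a solution of the master equation $$U_t+\frac12\pi^{\ast2}U_{xx}+\pi^{\ast}(bU_x+U_{xy})+\pi^{\ast}\mathcal{L}_1U+\mathcal{L}_2U+b\,\mathcal{L}_3U+\mathcal{L}_4U+\frac12U_{yy}+bU_y=0$$ in $\mathbb{R}\times\mathbb{R}\times\mathcal{P}_2\times[0,T)$, with terminal condition $U(x,y,m,T)=J(x-C(m))$, is given, for $(x,y,m,t)\in\mathbb{R}\times\mathbb{R}\times\mathcal{P}_2\times[0,T]$, by $$U(x,y,m,t)=u(x-f(y,m,t),y,t).$$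
   Context: $\mathcal{P}_2$ is the space of probability measures on $\mathbb{R}$ with finite second moment. For a function $v$ of $m\in\mathcal{P}_2$, $v_m(m,z)$ denotes the (Lions, intrinsic) derivative in $m$ evaluated at $z\in\mathbb{R}$ (so that for $v(m)=\phi(\int z\,dm(z))$, $v_m(m,z)=\phi'(\int z\,dm(z))$), $v_{mz}$ its derivative in $z$, $v_{mm}(m,z_1,z_2)$ the second such derivative, and $v_{xm},v_{ym}$ the mixed derivatives. Given $\pi^{\ast}$, for $v=v(x,y,m,t)$ (or $v=v(y,m,t)$, suppressing $x$), $$\mathcal{L}_1v=\int\pi^{\ast}(z,y,m,t)v_{xm}(x,y,m,z,t)\,dm(z),$$ $$\mathcal{L}_2v=\frac12\iint\pi^{\ast}(z_1,y,m,t)\pi^{\ast}(z_2,y,m,t)v_{mm}(x,y,m,z_1,z_2,t)\,dm(z_1)dm(z_2)+\frac12\int(\pi^{\ast}(z,y,m,t))^2v_{mz}(x,y,m,z,t)\,dm(z),$$ $$\mathcal{L}_3v=\int\pi^{\ast}(z,y,m,t)v_m(x,y,m,z,t)\,dm(z),\qquad\mathcal{L}_4v=\int\pi^{\ast}(z,y,m,t)v_{ym}(x,y,m,z,t)\,dm(z).$$ "Smooth" for $f$ means that all derivatives involved exist. Single-agent problem. $T>0$; $\nu$ is a probability measure on $[\theta_1,\theta_2]$, $0<\theta_1<\theta_2<\infty$; $F(y,t)=\int_{\theta_1}^{\theta_2}e^{y\theta-\frac12\theta^2t}d\nu(\theta)$ and $b=F_y/F$ on $\mathbb{R}\times[0,T]$;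 $W$ is a Brownian motion, $dY_s=b(Y_s,s)ds+dW_s$; wealth $d\mathcal{X}_s=b(Y_s,s)\alpha_sds+\alpha_sdW_s$, $\mathcal{X}_t=x$, with $\alpha$ adapted to the filtration of $Y$ and $\mathbb{E}\int_0^T\alpha_s^2ds<\infty$; $u(x,y,t)=\sup_{\alpha}\mathbb{E}[J(\mathcal{X}_T)\mid\mathcal{X}_t=x,Y_t=y]$. Utility. $J:\mathbb{R}\to\mathbb{R}$ is a strictly concave, strictly increasing $\mathcal{C}^4$ function; with $r=-J'/J''$ and $I=(J')^{(-1)}:(0,\infty)\to\mathbb{R}$, there exist $A,B,c_0>0$ and $\gamma>1$ such that, for all $x\in\mathbb{R}$, $B\le r(x)\le\sqrt{Ax^2+B}$ and $|r'(x)|\le A$, and $\lim_{z\to\infty}z^\gamma I(z)=c_0$. The function $u$ is $\mathcal{C}^{2,2,1}$ (twice continuously differentiable in $x,y$, once in $t$), strictly increasing and strictly concave in $x$, and satisfies $$u_t-\frac{(bu_x+u_{xy})^2}{2u_{xx}}+\frac12u_{yy}+bu_y=0\ \text{ in }\mathbb{R}\times\mathbb{R}\times[0,T),\qquad u(x,y,T)=J(x).$$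
   Formalization: The utility condition lim z^γ I(z)=c0>0 is taken as z→0+ instead of z→∞, since I=(J')^{-1} is decreasing onto R and negative for large z, so the condition at infinity can never hold; u_xx≠0, presupposed by a* and the equation for u, is stated explicitly. *)

theory Defs
  imports "HOL-Probability.Probability"
begin

section \<open>The space P2 and Lions derivatives\<close>

definition P2 :: "real measure set" where
  "P2 = {m. prob_space m \<and> sets m = sets borel \<and> integrable m (\<lambda>z. z\<^sup>2)}"

text \<open>Lions derivatives are defined by lifting a function of the measure to random variables on
  an atomless probability space. We use the unit interval with Lebesgue measure; every element
  of \<open>P2\<close> is the law of some square integrable random variable on it.\<close>

definition unit_space :: "real measure" where
  "unit_space = uniform_measure lborel {0..1}"

definition L2_unit :: "(real \<Rightarrow> real) set" where
  "L2_unit = {X \<in> borel_measurable unit_space. integrable unit_space (\<lambda>\<omega>. (X \<omega>)\<^sup>2)}"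

definition L2_norm_unit :: "(real \<Rightarrow> real) \<Rightarrow> real" where
  "L2_norm_unit X = sqrt (\<integral>\<omega>. (X \<omega>)\<^sup>2 \<partial>unit_space)"

definition law :: "(real \<Rightarrow> real) \<Rightarrow> real measure" where
  "law X = distr unit_space borel X"

text \<open>\<open>has_lions_derivative v p\<close>: the lift \<open>X \<mapsto> v (law X)\<close> is Frechet differentiable at every
  \<open>X\<close> in \<open>L2\<close>, with gradient the random variable \<open>p (law X) (X \<cdot>)\<close>. This alone fixes
  \<open>p m\<close> only up to \<open>m\<close>-null sets; as usual, the derivative evaluated at an arbitrary point
  \<open>z\<close> refers to the version that is jointly continuous in \<open>(m, z)\<close>, which is unique because
  measures of full support are dense. The Wasserstein topology is the quotient of the \<open>L2\<close>
  topology under \<open>law\<close>, so continuity is expressed through the lift.\<close>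

definition has_lions_derivative ::
  "(real measure \<Rightarrow> real) \<Rightarrow> (real measure \<Rightarrow> real \<Rightarrow> real) \<Rightarrow> bool" where
  "has_lions_derivative v p \<longleftrightarrow>
     (\<forall>X\<in>L2_unit.
        (\<lambda>\<omega>. p (law X) (X \<omega>)) \<in> L2_unit \<and>
        (\<forall>e>0. \<exists>d>0. \<forall>H\<in>L2_unit. L2_norm_unit H < d \<longrightarrow>
           \<bar>v (law (\<lambda>\<omega>. X \<omega> + H \<omega>)) - v (law X) - (\<integral>\<omega>. p (law X) (X \<omega>) * H \<omega> \<partial>unit_space)\<bar>
             \<le> e * L2_norm_unit H)) \<and>
     (\<forall>X\<in>L2_unit. \<forall>z. \<forall>e>0. \<exists>d>0. \<forall>X'\<in>L2_unit. \<forall>z'.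
        L2_norm_unit (\<lambda>\<omega>. X' \<omega> - X \<omega>) < d \<and> \<bar>z' - z\<bar> < d \<longrightarrow>
          \<bar>p (law X') z' - p (law X) z\<bar> < e)"


section \<open>The operators of the master equation\<close>

text \<open>The operators act on the derivatives of \<open>v\<close> as functions of the measure variables, with all
  other arguments frozen. Throughout, \<open>\<pi>\<close> takes its arguments in the order \<open>z, y, m, t\<close>, and in
  \<open>vmm\<close> the variable \<open>z1\<close> comes from the first differentiation.\<close>

definition L1 where
  "L1 \<pi> y m t (vxm :: real \<Rightarrow> real) = (\<integral>z. \<pi> z y m t * vxm z \<partial>m)"
  for \<pi> :: "real \<Rightarrow> real \<Rightarrow> real measure \<Rightarrow> real \<Rightarrow> real"

definition L2 where
  "L2 \<pi> y m t (vmm :: real \<Rightarrow> real \<Rightarrow> real) (vmz :: real \<Rightarrow> real) =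
     1/2 * (\<integral>(z1, z2). \<pi> z1 y m t * \<pi> z2 y m t * vmm z1 z2 \<partial>(m \<Otimes>\<^sub>M m)) +
     1/2 * (\<integral>z. (\<pi> z y m t)\<^sup>2 * vmz z \<partial>m)"
  for \<pi> :: "real \<Rightarrow> real \<Rightarrow> real measure \<Rightarrow> real \<Rightarrow> real"

definition L3 where
  "L3 \<pi> y m t (vm :: real \<Rightarrow> real) = (\<integral>z. \<pi> z y m t * vm z \<partial>m)"
  for \<pi> :: "real \<Rightarrow> real \<Rightarrow> real measure \<Rightarrow> real \<Rightarrow> real"

definition L4 where
  "L4 \<pi> y m t (vym :: real \<Rightarrow> real) = (\<integral>z. \<pi> z y m t * vym z \<partial>m)"
  for \<pi> :: "real \<Rightarrow> real \<Rightarrow> real measure \<Rightarrow> real \<Rightarrow> real"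

text \<open>The Bochner integral of a nonintegrable function is 0 in the library, so existence of the
  integrals has to be stated separately.\<close>

definition single_defined where
  "single_defined \<pi> y m t (g :: real \<Rightarrow> real) \<longleftrightarrow> integrable m (\<lambda>z. \<pi> z y m t * g z)"
  for \<pi> :: "real \<Rightarrow> real \<Rightarrow> real measure \<Rightarrow> real \<Rightarrow> real"

definition L2_defined where
  "L2_defined \<pi> y m t (vmm :: real \<Rightarrow> real \<Rightarrow> real) (vmz :: real \<Rightarrow> real) \<longleftrightarrow>
     integrable (m \<Otimes>\<^sub>M m) (\<lambda>(z1, z2). \<pi> z1 y m t * \<pi> z2 y m t * vmm z1 z2) \<and>
     integrable m (\<lambda>z. (\<pi> z y m t)\<^sup>2 * vmz z)"
  for \<pi> :: "real \<Rightarrow> real \<Rightarrow> real measure \<Rightarrow> real \<Rightarrow> real"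


section \<open>The single-agent problem\<close>

definition prior_on :: "real \<Rightarrow> real \<Rightarrow> real measure \<Rightarrow> bool" where
  "prior_on \<theta>1 \<theta>2 \<nu> \<longleftrightarrow> prob_space \<nu> \<and> sets \<nu> = sets borel \<and> measure \<nu> {\<theta>1..\<theta>2} = 1"

definition F_prior :: "real \<Rightarrow> real \<Rightarrow> real measure \<Rightarrow> real \<Rightarrow> real \<Rightarrow> real" where
  "F_prior \<theta>1 \<theta>2 \<nu> y t = (LINT \<theta>:{\<theta>1..\<theta>2}|\<nu>. exp (y * \<theta> - 1/2 * \<theta>\<^sup>2 * t))"

definition drift :: "real \<Rightarrow> real \<Rightarrow> real measure \<Rightarrow> real \<Rightarrow> real \<Rightarrow> real" where
  "drift \<theta>1 \<theta>2 \<nu> y t = deriv (\<lambda>\<eta>. F_prior \<theta>1 \<theta>2 \<nu> \<eta> t) y / F_prior \<theta>1 \<theta>2 \<nu> y t"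

definition natural_filtration ::
  "'w measure \<Rightarrow> real \<Rightarrow> (real \<Rightarrow> 'w \<Rightarrow> real) \<Rightarrow> real \<Rightarrow> 'w measure" where
  "natural_filtration M t0 X s =
     sigma (space M) (\<Union>r\<in>{t0..s}. {X r -` B \<inter> space M | B. B \<in> sets borel})"

definition brownian_motion :: "'w measure \<Rightarrow> (real \<Rightarrow> 'w \<Rightarrow> real) \<Rightarrow> bool" where
  "brownian_motion M W \<longleftrightarrow>
     prob_space M \<and>
     (\<forall>s\<ge>0. W s \<in> borel_measurable M) \<and>
     (AE \<omega> in M. W 0 \<omega> = 0) \<and>
     (AE \<omega> in M. continuous_on {0..} (\<lambda>s. W s \<omega>)) \<and>
     (\<forall>r s. 0 \<le> r \<and> r < s \<longrightarrow>
        distributed M lborel (\<lambda>\<omega>. W s \<omega> - W r \<omega>) (normal_density 0 (sqrt (s - r))) \<and>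
        prob_space.indep_set M
          (sets (natural_filtration M 0 W r))
          (sets (vimage_algebra (space M) (\<lambda>\<omega>. W s \<omega> - W r \<omega>) borel)))"

text \<open>\<open>Y\<close> solves \<open>dY = b(Y, s) ds + dW\<close> on \<open>[t, T]\<close> with \<open>Y t = y\<close>.\<close>

definition solves_sde ::
  "'w measure \<Rightarrow> (real \<Rightarrow> 'w \<Rightarrow> real) \<Rightarrow> (real \<Rightarrow> real \<Rightarrow> real) \<Rightarrow> real \<Rightarrow> real \<Rightarrow> real
    \<Rightarrow> (real \<Rightarrow> 'w \<Rightarrow> real) \<Rightarrow> bool" where
  "solves_sde M W b T t y Y \<longleftrightarrow>
     (\<forall>s\<in>{t..T}. Y s \<in> borel_measurable M) \<and>
     (AE \<omega> in M. continuous_on {t..T} (\<lambda>s. Y s \<omega>) \<and>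
        (\<forall>s\<in>{t..T}. Y s \<omega> = y + (LBINT r:{t..s}. b (Y r \<omega>) r) + (W s \<omega> - W t \<omega>)))"

text \<open>Elementary integrands are \<open>\<Sum>i<n. \<xi> i * 1_(\<tau> i, \<tau> (i+1)]\<close> on a partition \<open>\<tau>\<close> of \<open>[t, T]\<close>; the
  Ito integral \<open>Z\<close> of \<open>\<alpha>\<close> is the \<open>L2\<close> limit of the elementary integrals, hence unique up to
  null sets.\<close>

definition elementary ::
  "(real \<Rightarrow> 'w measure) \<Rightarrow> real \<Rightarrow> real \<Rightarrow> nat \<Rightarrow> (nat \<Rightarrow> real) \<Rightarrow> (nat \<Rightarrow> 'w \<Rightarrow> real) \<Rightarrow> bool" where
  "elementary Fil t T n \<tau> \<xi> \<longleftrightarrow>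
     \<tau> 0 = t \<and> \<tau> n = T \<and>
     (\<forall>i<n. \<tau> i \<le> \<tau> (Suc i) \<and> \<xi> i \<in> borel_measurable (Fil (\<tau> i)) \<and>
        (\<exists>K. \<forall>\<omega>\<in>space (Fil (\<tau> i)). \<bar>\<xi> i \<omega>\<bar> \<le> K))"

definition ito_integral ::
  "'w measure \<Rightarrow> (real \<Rightarrow> 'w \<Rightarrow> real) \<Rightarrow> (real \<Rightarrow> 'w measure) \<Rightarrow> real \<Rightarrow> real
    \<Rightarrow> (real \<Rightarrow> 'w \<Rightarrow> real) \<Rightarrow> ('w \<Rightarrow> real) \<Rightarrow> bool" where
  "ito_integral M W Fil t T \<alpha> Z \<longleftrightarrow>
     Z \<in> borel_measurable M \<and>
     (\<exists>(n :: nat \<Rightarrow> nat) (\<tau> :: nat \<Rightarrow> nat \<Rightarrow> real) (\<xi> :: nat \<Rightarrow> nat \<Rightarrow> 'w \<Rightarrow> real).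
        (\<forall>k. elementary Fil t T (n k) (\<tau> k) (\<xi> k)) \<and>
        (\<lambda>k. \<integral>\<^sup>+(s, \<omega>). ennreal ((\<alpha> s \<omega> -
                (\<Sum>i<n k. indicator {\<tau> k i<..\<tau> k (Suc i)} s * \<xi> k i \<omega>))\<^sup>2)
              \<partial>(restrict_space lborel {t..T} \<Otimes>\<^sub>M M)) \<longlonglongrightarrow> 0 \<and>
        (\<lambda>k. \<integral>\<^sup>+\<omega>. ennreal ((Z \<omega> -
                (\<Sum>i<n k. \<xi> k i \<omega> * (W (\<tau> k (Suc i)) \<omega> - W (\<tau> k i) \<omega>)))\<^sup>2) \<partial>M) \<longlonglongrightarrow> 0)"

definition admissible ::
  "'w measure \<Rightarrow> (real \<Rightarrow> 'w measure) \<Rightarrow> real \<Rightarrow> real \<Rightarrow> (real \<Rightarrow> 'w \<Rightarrow> real) \<Rightarrow> bool" where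
  "admissible M Fil t T \<alpha> \<longleftrightarrow>
     (\<lambda>(s, \<omega>). \<alpha> s \<omega>) \<in> borel_measurable (restrict_space lborel {t..T} \<Otimes>\<^sub>M M) \<and>
     (\<forall>s\<in>{t..T}. \<alpha> s \<in> borel_measurable (Fil s)) \<and>
     integrable (restrict_space lborel {t..T} \<Otimes>\<^sub>M M) (\<lambda>(s, \<omega>). (\<alpha> s \<omega>)\<^sup>2)"

text \<open>For concave \<open>J\<close> and integrable wealth the positive part of \<open>J(X)\<close> is always integrable, so
  nonintegrability means that the expectation is \<open>-\<infinity>\<close>.\<close>

definition expected_utility :: "'w measure \<Rightarrow> (real \<Rightarrow> real) \<Rightarrow> ('w \<Rightarrow> real) \<Rightarrow> ereal" where
  "expected_utility M J X =
     (if integrable M (\<lambda>\<omega>. J (X \<omega>)) then ereal (\<integral>\<omega>. J (X \<omega>) \<partial>M) else -\<infinity>)"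

text \<open>Conditioning on wealth \<open>x\<close> and signal \<open>y\<close> at time \<open>t\<close> means starting both processes there
  at time \<open>t\<close>; \<open>Y t y\<close> is the signal started from \<open>y\<close> at time \<open>t\<close>.\<close>

definition is_value_function ::
  "'w measure \<Rightarrow> (real \<Rightarrow> 'w \<Rightarrow> real) \<Rightarrow> (real \<Rightarrow> real \<Rightarrow> real) \<Rightarrow> (real \<Rightarrow> real) \<Rightarrow> real
    \<Rightarrow> (real \<Rightarrow> real \<Rightarrow> real \<Rightarrow> 'w \<Rightarrow> real) \<Rightarrow> (real \<Rightarrow> real \<Rightarrow> real \<Rightarrow> real) \<Rightarrow> bool" where
  "is_value_function M W b J T Y u \<longleftrightarrow>
     (\<forall>x y. \<forall>t\<in>{0..T}.
        ereal (u x y t) =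
          (SUP (\<alpha>, Z) \<in> {(\<alpha>, Z). admissible M (natural_filtration M t (Y t y)) t T \<alpha> \<and>
                              ito_integral M W (natural_filtration M t (Y t y)) t T \<alpha> Z}.
             expected_utility M J
               (\<lambda>\<omega>. x + (LBINT s:{t..T}. b (Y t y s \<omega>) s * \<alpha> s \<omega>) + Z \<omega>)))"

definition strictly_concave :: "(real \<Rightarrow> real) \<Rightarrow> bool" where
  "strictly_concave g \<longleftrightarrow>
     (\<forall>x y a. x \<noteq> y \<and> 0 < a \<and> a < 1 \<longrightarrow>
        a * g x + (1 - a) * g y < g (a * x + (1 - a) * y))"

definition C4 :: "(real \<Rightarrow> real) \<Rightarrow> bool" where
  "C4 g \<longleftrightarrow> (\<forall>k<4. \<forall>x. (deriv ^^ k) g differentiable (at x)) \<and>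
     continuous_on UNIV ((deriv ^^ 4) g)"

definition risk_tolerance :: "(real \<Rightarrow> real) \<Rightarrow> real \<Rightarrow> real" where
  "risk_tolerance J x = - deriv J x / deriv (deriv J) x"

text \<open>The condition on the inverse marginal utility \<open>I\<close> is imposed as \<open>z\<close> tends to 0 from the
  right: \<open>I\<close> is decreasing onto the real line, so it tends to \<open>-\<infinity>\<close> as \<open>z\<close> tends to
  infinity and \<open>z powr \<gamma> * I z\<close> can have a positive limit only at 0.\<close>

definition utility :: "(real \<Rightarrow> real) \<Rightarrow> bool" where
  "utility J \<longleftrightarrow>
     C4 J \<and> strict_mono J \<and> strictly_concave J \<and>
     bij_betw (deriv J) UNIV {0<..} \<and>
     (\<exists>A B c0 \<gamma>. A > 0 \<and> B > 0 \<and> c0 > 0 \<and> \<gamma> > 1 \<and>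
        (\<forall>x. B \<le> risk_tolerance J x \<and> risk_tolerance J x \<le> sqrt (A * x\<^sup>2 + B) \<and>
             \<bar>deriv (risk_tolerance J) x\<bar> \<le> A) \<and>
        ((\<lambda>z. z powr \<gamma> * inv_into UNIV (deriv J) z) \<longlongrightarrow> c0) (at_right 0))"

definition C221 where
  "C221 T u ux uy uxx uxy uyx uyy ut \<longleftrightarrow>
     (\<forall>x y. \<forall>t\<in>{0..T}.
        ((\<lambda>\<xi>. u \<xi> y t) has_real_derivative ux x y t) (at x) \<and>
        ((\<lambda>\<eta>. u x \<eta> t) has_real_derivative uy x y t) (at y) \<and>
        ((\<lambda>\<xi>. ux \<xi> y t) has_real_derivative uxx x y t) (at x) \<and>
        ((\<lambda>\<eta>. ux x \<eta> t) has_real_derivative uxy x y t) (at y) \<and>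
        ((\<lambda>\<xi>. uy \<xi> y t) has_real_derivative uyx x y t) (at x) \<and>
        ((\<lambda>\<eta>. uy x \<eta> t) has_real_derivative uyy x y t) (at y) \<and>
        ((\<lambda>s. u x y s) has_real_derivative ut x y t) (at t within {0..T})) \<and>
     (\<forall>g\<in>{u, ux, uy, uxx, uxy, uyx, uyy, ut}.
        continuous_on (UNIV \<times> UNIV \<times> {0..T}) (\<lambda>(x, y, t). g x y t))"
  for u ux uy uxx uxy uyx uyy ut :: "real \<Rightarrow> real \<Rightarrow> real \<Rightarrow> real"

text \<open>The clause \<open>uxx \<noteq> 0\<close> makes the quotients in the equation and in the feedback meaningful;
  strict concavity alone does not exclude isolated zeros of \<open>uxx\<close>.\<close>

definition hjb_solution where
  "hjb_solution T b J u ux uy uxx uxy uyy ut \<longleftrightarrow>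
     (\<forall>x y. \<forall>t\<in>{0..T}. uxx x y t \<noteq> 0) \<and>
     (\<forall>x y. \<forall>t\<in>{0..<T}.
        ut x y t - (b y t * ux x y t + uxy x y t)\<^sup>2 / (2 * uxx x y t)
          + 1/2 * uyy x y t + b y t * uy x y t = 0) \<and>
     (\<forall>x y. u x y T = J x)"
  for u ux uy uxx uxy uyy ut :: "real \<Rightarrow> real \<Rightarrow> real \<Rightarrow> real"

definition optimal_feedback where
  "optimal_feedback b ux uxx uxy x y t = - (b y t * ux x y t + uxy x y t) / uxx x y t"
  for b :: "real \<Rightarrow> real \<Rightarrow> real" and ux uxx uxy :: "real \<Rightarrow> real \<Rightarrow> real \<Rightarrow> real"


section \<open>Smooth solutions of the two equations\<close>

text \<open>Derivatives that occur only in the equation on \<open>[0, T)\<close> are required there only; \<open>fy\<close> and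
  \<open>fm\<close> also enter the fixed point relation for \<open>\<pi>\<close> at the terminal time.\<close>

definition f_solution where
  "f_solution T C \<pi> f ft fy fyy fm fmm fmz fym \<longleftrightarrow>
     (\<forall>y. \<forall>m\<in>P2. continuous_on {0..T} (\<lambda>t. f y m t)) \<and>
     (\<forall>y. \<forall>m\<in>P2. \<forall>t\<in>{0..T}. ((\<lambda>\<eta>. f \<eta> m t) has_real_derivative fy y m t) (at y)) \<and>
     (\<forall>y. \<forall>t\<in>{0..T}. has_lions_derivative (\<lambda>m. f y m t) (\<lambda>m z. fm y m z t)) \<and>
     (\<forall>y. \<forall>m\<in>P2. \<forall>t\<in>{0..<T}.
        ((\<lambda>s. f y m s) has_real_derivative ft y m t) (at t within {0..T}) \<and>
        ((\<lambda>\<eta>. fy \<eta> m t) has_real_derivative fyy y m t) (at y) \<and>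
        (\<forall>z. ((\<lambda>\<zeta>. fm y m \<zeta> t) has_real_derivative fmz y m z t) (at z))) \<and>
     (\<forall>y. \<forall>t\<in>{0..<T}.
        has_lions_derivative (\<lambda>m. fy y m t) (\<lambda>m z. fym y m z t) \<and>
        (\<forall>z1. has_lions_derivative (\<lambda>m. fm y m z1 t) (\<lambda>m z2. fmm y m z1 z2 t))) \<and>
     (\<forall>y. \<forall>m\<in>P2. \<forall>t\<in>{0..<T}.
        L2_defined \<pi> y m t (\<lambda>z1 z2. fmm y m z1 z2 t) (\<lambda>z. fmz y m z t) \<and>
        single_defined \<pi> y m t (\<lambda>z. fym y m z t) \<and>
        ft y m t + L2 \<pi> y m t (\<lambda>z1 z2. fmm y m z1 z2 t) (\<lambda>z. fmz y m z t)
          + L4 \<pi> y m t (\<lambda>z. fym y m z t) + 1/2 * fyy y m t = 0) \<and>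
     (\<forall>y. \<forall>m\<in>P2. f y m T = C m)"
  for f ft fy fyy :: "real \<Rightarrow> real measure \<Rightarrow> real \<Rightarrow> real"
    and fm fmz fym :: "real \<Rightarrow> real measure \<Rightarrow> real \<Rightarrow> real \<Rightarrow> real"
    and fmm :: "real \<Rightarrow> real measure \<Rightarrow> real \<Rightarrow> real \<Rightarrow> real \<Rightarrow> real"
    and \<pi> :: "real \<Rightarrow> real \<Rightarrow> real measure \<Rightarrow> real \<Rightarrow> real"

definition pi_relation where
  "pi_relation T a f fy fm \<pi> \<longleftrightarrow>
     (\<forall>x y. \<forall>m\<in>P2. \<forall>t\<in>{0..T}.
        integrable m (\<lambda>z. \<pi> z y m t * fm y m z t) \<and>
        \<pi> x y m t - (\<integral>z. \<pi> z y m t * fm y m z t \<partial>m) = fy y m t + a (x - f y m t) y t)"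
  for f fy :: "real \<Rightarrow> real measure \<Rightarrow> real \<Rightarrow> real"
    and fm :: "real \<Rightarrow> real measure \<Rightarrow> real \<Rightarrow> real \<Rightarrow> real"
    and \<pi> :: "real \<Rightarrow> real \<Rightarrow> real measure \<Rightarrow> real \<Rightarrow> real"
    and a :: "real \<Rightarrow> real \<Rightarrow> real \<Rightarrow> real"

definition master_solution ::
  "real \<Rightarrow> (real \<Rightarrow> real \<Rightarrow> real) \<Rightarrow> (real \<Rightarrow> real) \<Rightarrow> (real measure \<Rightarrow> real)
    \<Rightarrow> (real \<Rightarrow> real \<Rightarrow> real measure \<Rightarrow> real \<Rightarrow> real)
    \<Rightarrow> (real \<Rightarrow> real \<Rightarrow> real measure \<Rightarrow> real \<Rightarrow> real) \<Rightarrow> bool" where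
  "master_solution T b J C \<pi> U \<longleftrightarrow>
     (\<forall>x y. \<forall>m\<in>P2. continuous_on {0..T} (\<lambda>t. U x y m t)) \<and>
     (\<exists>(Ut :: real \<Rightarrow> real \<Rightarrow> real measure \<Rightarrow> real \<Rightarrow> real)
       (Ux :: real \<Rightarrow> real \<Rightarrow> real measure \<Rightarrow> real \<Rightarrow> real)
       (Uxx :: real \<Rightarrow> real \<Rightarrow> real measure \<Rightarrow> real \<Rightarrow> real)
       (Uxy :: real \<Rightarrow> real \<Rightarrow> real measure \<Rightarrow> real \<Rightarrow> real)
       (Uy :: real \<Rightarrow> real \<Rightarrow> real measure \<Rightarrow> real \<Rightarrow> real)
       (Uyy :: real \<Rightarrow> real \<Rightarrow> real measure \<Rightarrow> real \<Rightarrow> real)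
       (Um :: real \<Rightarrow> real \<Rightarrow> real measure \<Rightarrow> real \<Rightarrow> real \<Rightarrow> real)
       (Umm :: real \<Rightarrow> real \<Rightarrow> real measure \<Rightarrow> real \<Rightarrow> real \<Rightarrow> real \<Rightarrow> real)
       (Umz :: real \<Rightarrow> real \<Rightarrow> real measure \<Rightarrow> real \<Rightarrow> real \<Rightarrow> real)
       (Uxm :: real \<Rightarrow> real \<Rightarrow> real measure \<Rightarrow> real \<Rightarrow> real \<Rightarrow> real)
       (Uym :: real \<Rightarrow> real \<Rightarrow> real measure \<Rightarrow> real \<Rightarrow> real \<Rightarrow> real).
       (\<forall>x y. \<forall>m\<in>P2. \<forall>t\<in>{0..<T}.
          ((\<lambda>s. U x y m s) has_real_derivative Ut x y m t) (at t within {0..T}) \<and>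
          ((\<lambda>\<xi>. U \<xi> y m t) has_real_derivative Ux x y m t) (at x) \<and>
          ((\<lambda>\<xi>. Ux \<xi> y m t) has_real_derivative Uxx x y m t) (at x) \<and>
          ((\<lambda>\<eta>. Ux x \<eta> m t) has_real_derivative Uxy x y m t) (at y) \<and>
          ((\<lambda>\<eta>. U x \<eta> m t) has_real_derivative Uy x y m t) (at y) \<and>
          ((\<lambda>\<eta>. Uy x \<eta> m t) has_real_derivative Uyy x y m t) (at y) \<and>
          (\<forall>z. ((\<lambda>\<zeta>. Um x y m \<zeta> t) has_real_derivative Umz x y m z t) (at z))) \<and>
       (\<forall>x y. \<forall>t\<in>{0..<T}.
          has_lions_derivative (\<lambda>m. U x y m t) (\<lambda>m z. Um x y m z t) \<and>
          (\<forall>z1. has_lions_derivative (\<lambda>m. Um x y m z1 t) (\<lambda>m z2. Umm x y m z1 z2 t)) \<and>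
          has_lions_derivative (\<lambda>m. Ux x y m t) (\<lambda>m z. Uxm x y m z t) \<and>
          has_lions_derivative (\<lambda>m. Uy x y m t) (\<lambda>m z. Uym x y m z t)) \<and>
       (\<forall>x y. \<forall>m\<in>P2. \<forall>t\<in>{0..<T}.
          single_defined \<pi> y m t (\<lambda>z. Uxm x y m z t) \<and>
          L2_defined \<pi> y m t (\<lambda>z1 z2. Umm x y m z1 z2 t) (\<lambda>z. Umz x y m z t) \<and>
          single_defined \<pi> y m t (\<lambda>z. Um x y m z t) \<and>
          single_defined \<pi> y m t (\<lambda>z. Uym x y m z t) \<and>
          Ut x y m t + 1/2 * (\<pi> x y m t)\<^sup>2 * Uxx x y m t
            + \<pi> x y m t * (b y t * Ux x y m t + Uxy x y m t)
            + \<pi> x y m t * L1 \<pi> y m t (\<lambda>z. Uxm x y m z t)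
            + L2 \<pi> y m t (\<lambda>z1 z2. Umm x y m z1 z2 t) (\<lambda>z. Umz x y m z t)
            + b y t * L3 \<pi> y m t (\<lambda>z. Um x y m z t)
            + L4 \<pi> y m t (\<lambda>z. Uym x y m z t)
            + 1/2 * Uyy x y m t + b y t * Uy x y m t = 0)) \<and>
     (\<forall>x y. \<forall>m\<in>P2. U x y m T = J (x - C m))"

end

theory Submission
  imports Defs "HOL-Library.Landau_Symbols"
begin

text \<open>
  Write \<open>\<xi> = x - f(y, m, t)\<close>, so that \<open>U(x, y, m, t) = u(\<xi>, y, t)\<close>. Every derivative of \<open>U\<close> is
  computed by the chain rule from those of \<open>u\<close> and \<open>f\<close>, and the equation for \<open>U\<close> becomes an identity
  between them. Let \<open>i = \<integral> \<pi> f_m dm\<close>. The terms with \<open>f_t\<close> or a second derivative of \<open>f\<close> add up to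
  \<open>- u_x\<close> times the left side of the equation for \<open>f\<close>, hence vanish. The products of first derivatives
  of \<open>f\<close> complete a square with \<open>\<pi>\<close>: what remains is
  \<open>u_t + u_yy / 2 + b u_y + q (b u_x + u_xy) + q\<^sup>2 u_xx / 2\<close> with \<open>q = \<pi> - i - f_y\<close>. The relation for
  \<open>\<pi>\<close> says exactly that \<open>q\<close> is the optimal feedback \<open>a\<close> at \<open>\<xi>\<close>, which is the critical point of this
  quadratic in \<open>q\<close>, and there the expression is the left side of the equation for \<open>u\<close>. In
  probabilistic terms, the wealth relative to the benchmark \<open>f\<close> is controlled as in the single-agent
  problem.

  This algebra is \<open>master_equation_algebra\<close>. What makes it applicable is: chain, product and difference
  rules for Lions derivatives (\<open>has_lions_derivative_compose\<close>, \<open>has_lions_derivative_mult\<close>,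
  \<open>has_lions_derivative_diff\<close>), each including the joint continuity of the derivative; a chain rule
  for a function of two variables one of which enters twice
  (\<open>has_real_derivative_moving_argument\<close>); the equality \<open>u_xy = u_yx\<close>
  (\<open>mixed_partials_commute\<close>), since the \<open>m\<close>-derivative of \<open>U_y\<close> produces \<open>u_yx\<close> while the
  equation for \<open>u\<close> contains \<open>u_xy\<close>; and the evaluation of the second-order operator on \<open>U\<close>
  (\<open>L2_composition\<close>), where the square \<open>i\<^sup>2\<close> comes from Fubini's theorem.
\<close>

section \<open>The mean square space of the unit interval\<close>

lemma L2_unit_measurable: "X \<in> L2_unit \<Longrightarrow> X \<in> borel_measurable unit_space"
  and L2_unit_square_integrable: "X \<in> L2_unit \<Longrightarrow> integrable unit_space (\<lambda>\<omega>. (X \<omega>)\<^sup>2)"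
  by (auto simp: L2_unit_def)

lemma L2_unit_mult_integrable:
  assumes "X \<in> L2_unit" "Y \<in> L2_unit"
  shows "integrable unit_space (\<lambda>\<omega>. X \<omega> * Y \<omega>)"
proof (rule Bochner_Integration.integrable_bound)
  show "integrable unit_space (\<lambda>\<omega>. (X \<omega>)\<^sup>2 + (Y \<omega>)\<^sup>2)"
    using assms by (intro Bochner_Integration.integrable_add L2_unit_square_integrable)
  show "(\<lambda>\<omega>. X \<omega> * Y \<omega>) \<in> borel_measurable unit_space"
    using assms by (intro borel_measurable_times L2_unit_measurable)
  have "\<bar>x * y\<bar> \<le> x\<^sup>2 + y\<^sup>2" for x y :: real
  proof -
    have "\<bar>x * y\<bar> \<le> 2 * \<bar>x\<bar> * \<bar>y\<bar>" by (simp add: abs_mult)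
    also have "\<dots> \<le> x\<^sup>2 + y\<^sup>2" using sum_squares_bound[of "\<bar>x\<bar>" "\<bar>y\<bar>"] by simp
    finally show ?thesis .
  qed
  then show "AE \<omega> in unit_space. norm (X \<omega> * Y \<omega>) \<le> norm ((X \<omega>)\<^sup>2 + (Y \<omega>)\<^sup>2)"
    by simp
qed

lemma L2_unit_add:
  assumes "X \<in> L2_unit" "Y \<in> L2_unit"
  shows "(\<lambda>\<omega>. X \<omega> + Y \<omega>) \<in> L2_unit"
proof -
  have "integrable unit_space (\<lambda>\<omega>. (X \<omega>)\<^sup>2 + 2 * (X \<omega> * Y \<omega>) + (Y \<omega>)\<^sup>2)"
    using assms by (intro Bochner_Integration.integrable_add integrable_mult_right
        L2_unit_square_integrable L2_unit_mult_integrable)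
  then show ?thesis
    using assms by (auto simp: L2_unit_def power2_sum algebra_simps intro: borel_measurable_add)
qed

lemma L2_unit_scale: "X \<in> L2_unit \<Longrightarrow> (\<lambda>\<omega>. c * X \<omega>) \<in> L2_unit"
  by (auto simp: L2_unit_def power_mult_distrib intro: borel_measurable_times)

lemma L2_unit_diff:
  assumes "X \<in> L2_unit" "Y \<in> L2_unit"
  shows "(\<lambda>\<omega>. X \<omega> - Y \<omega>) \<in> L2_unit"
  using L2_unit_add[OF assms(1) L2_unit_scale[OF assms(2), of "-1"]] by simp

lemma L2_norm_unit_nonneg: "0 \<le> L2_norm_unit X"
  by (simp add: L2_norm_unit_def)

lemma L2_unit_Cauchy_Schwarz:
  assumes X: "X \<in> L2_unit" and Y: "Y \<in> L2_unit"
  shows "\<bar>\<integral>\<omega>. X \<omega> * Y \<omega> \<partial>unit_space\<bar> \<le> L2_norm_unit X * L2_norm_unit Y"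
proof -
  let ?I = "\<integral>\<omega>. \<bar>X \<omega> * Y \<omega>\<bar> \<partial>unit_space"
  have [measurable]: "X \<in> borel_measurable unit_space" "Y \<in> borel_measurable unit_space"
    using X Y by (simp_all add: L2_unit_measurable)
  have sq: "(\<integral>\<^sup>+\<omega>. (ennreal \<bar>Z \<omega>\<bar>)\<^sup>2 \<partial>unit_space) = ennreal ((L2_norm_unit Z)\<^sup>2)"
    if "Z \<in> L2_unit" for Z
    using that nn_integral_eq_integral[OF L2_unit_square_integrable[OF that]]
    by (simp add: L2_norm_unit_def ennreal_power)
  have "ennreal (?I\<^sup>2) = (\<integral>\<^sup>+\<omega>. ennreal \<bar>X \<omega>\<bar> * ennreal \<bar>Y \<omega>\<bar> \<partial>unit_space)\<^sup>2"
    using nn_integral_eq_integral[OF integrable_abs[OF L2_unit_mult_integrable[OF X Y]]]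
    by (simp add: abs_mult ennreal_mult ennreal_power)
  also have "\<dots> \<le> ennreal ((L2_norm_unit X)\<^sup>2) * ennreal ((L2_norm_unit Y)\<^sup>2)"
    using Cauchy_Schwarz_nn_integral[of "\<lambda>\<omega>. ennreal \<bar>X \<omega>\<bar>" unit_space "\<lambda>\<omega>. ennreal \<bar>Y \<omega>\<bar>"]
    by (simp add: sq X Y)
  also have "\<dots> = ennreal ((L2_norm_unit X * L2_norm_unit Y)\<^sup>2)"
    by (simp add: power_mult_distrib ennreal_mult)
  finally have "?I\<^sup>2 \<le> (L2_norm_unit X * L2_norm_unit Y)\<^sup>2"
    by simp
  then have "?I \<le> L2_norm_unit X * L2_norm_unit Y"
    by (rule power2_le_imp_le) (simp add: L2_norm_unit_nonneg)
  then show ?thesis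
    using integral_abs_bound[of unit_space "\<lambda>\<omega>. X \<omega> * Y \<omega>"] by linarith
qed

section \<open>Calculus of Lions derivatives\<close>

text \<open>The neighbourhoods of 0 in the mean square seminorm. With this filter the Frechet condition on
  the lift is literally a little-o statement and the continuity of the derivative is a limit, so
  that the rules for Landau symbols and for limits apply.\<close>

definition small_L2 :: "(real \<Rightarrow> real) filter" where
  "small_L2 = (INF d\<in>{0<..}. principal {H \<in> L2_unit. L2_norm_unit H < d})"

lemma eventually_small_L2:
  "eventually P small_L2 \<longleftrightarrow> (\<exists>d>0. \<forall>H\<in>L2_unit. L2_norm_unit H < d \<longrightarrow> P H)"
proof -
  have "eventually P small_L2 \<longleftrightarrow>
      (\<exists>d\<in>{0::real<..}. eventually P (principal {H \<in> L2_unit. L2_norm_unit H < d}))"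
    unfolding small_L2_def
  proof (rule eventually_INF_base)
    fix a b :: real
    assume "a \<in> {0<..}" "b \<in> {0<..}"
    then show "\<exists>x\<in>{0<..}. principal {H \<in> L2_unit. L2_norm_unit H < x}
        \<le> inf (principal {H \<in> L2_unit. L2_norm_unit H < a})
            (principal {H \<in> L2_unit. L2_norm_unit H < b})"
      by (intro bexI[of _ "min a b"]) auto
  qed auto
  then show ?thesis by (auto simp: eventually_principal)
qed

lemma small_L2_in_L2: "eventually (\<lambda>H. H \<in> L2_unit) small_L2"
  by (auto simp: eventually_small_L2 intro: exI[of _ 1])

lemma L2_norm_small_L2: "(L2_norm_unit \<longlongrightarrow> 0) small_L2"
  by (auto simp: tendsto_iff eventually_small_L2 L2_norm_unit_nonneg)

text \<open>Perturbations \<open>X'\<close> of \<open>X\<close> are parametrised by \<open>H = X' - X\<close>, so one filter serves both halves of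
  the definition.\<close>

lemma has_lions_derivative_iff:
  "has_lions_derivative v p \<longleftrightarrow>
     (\<forall>X\<in>L2_unit.
        (\<lambda>\<omega>. p (law X) (X \<omega>)) \<in> L2_unit \<and>
        (\<lambda>H. v (law (\<lambda>\<omega>. X \<omega> + H \<omega>)) - v (law X) - (\<integral>\<omega>. p (law X) (X \<omega>) * H \<omega> \<partial>unit_space))
          \<in> o[small_L2](L2_norm_unit) \<and>
        (\<forall>z. ((\<lambda>(H, z'). p (law (\<lambda>\<omega>. X \<omega> + H \<omega>)) z') \<longlongrightarrow> p (law X) z) (small_L2 \<times>\<^sub>F nhds z)))"
proof -
  have joint: "(\<forall>e>0. \<exists>d>0. \<forall>X'\<in>L2_unit. \<forall>z'.
        L2_norm_unit (\<lambda>\<omega>. X' \<omega> - X \<omega>) < d \<and> \<bar>z' - z\<bar> < d \<longrightarrow>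
          \<bar>p (law X') z' - p (law X) z\<bar> < e) \<longleftrightarrow>
      ((\<lambda>(H, z'). p (law (\<lambda>\<omega>. X \<omega> + H \<omega>)) z') \<longlongrightarrow> p (law X) z) (small_L2 \<times>\<^sub>F nhds z)"
    (is "(\<forall>e>0. ?A e) \<longleftrightarrow> _")
    if X: "X \<in> L2_unit" for X z
  proof -
    have "?A e \<longleftrightarrow> eventually (\<lambda>(H, z'). \<bar>p (law (\<lambda>\<omega>. X \<omega> + H \<omega>)) z' - p (law X) z\<bar> < e)
        (small_L2 \<times>\<^sub>F nhds z)" for e
    proof
      assume "?A e"
      then obtain d where d: "d > 0" "\<And>X' z'. X' \<in> L2_unit \<Longrightarrow>
          L2_norm_unit (\<lambda>\<omega>. X' \<omega> - X \<omega>) < d \<Longrightarrow> \<bar>z' - z\<bar> < d \<Longrightarrow>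
          \<bar>p (law X') z' - p (law X) z\<bar> < e"
        by blast
      have H: "eventually (\<lambda>H. H \<in> L2_unit \<and> L2_norm_unit H < d) small_L2"
        using d(1) by (auto simp: eventually_small_L2)
      have z: "eventually (\<lambda>z'. \<bar>z' - z\<bar> < d) (nhds z)"
        using d(1) by (auto simp: eventually_nhds_metric dist_real_def)
      show "eventually (\<lambda>(H, z'). \<bar>p (law (\<lambda>\<omega>. X \<omega> + H \<omega>)) z' - p (law X) z\<bar> < e)
          (small_L2 \<times>\<^sub>F nhds z)"
        unfolding eventually_prod_filter
        using H z d(2)[OF L2_unit_add[OF X]] by fastforce
    next
      assume "eventually (\<lambda>(H, z'). \<bar>p (law (\<lambda>\<omega>. X \<omega> + H \<omega>)) z' - p (law X) z\<bar> < e)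
          (small_L2 \<times>\<^sub>F nhds z)"
      then obtain d1 d2 where d: "d1 > 0" "d2 > 0"
        "\<And>H z'. H \<in> L2_unit \<Longrightarrow> L2_norm_unit H < d1 \<Longrightarrow> \<bar>z' - z\<bar> < d2 \<Longrightarrow>
          \<bar>p (law (\<lambda>\<omega>. X \<omega> + H \<omega>)) z' - p (law X) z\<bar> < e"
        unfolding eventually_prod_filter eventually_small_L2 eventually_nhds_metric dist_real_def
        by fastforce
      have "\<bar>p (law X') z' - p (law X) z\<bar> < e"
        if "X' \<in> L2_unit" "L2_norm_unit (\<lambda>\<omega>. X' \<omega> - X \<omega>) < min d1 d2" "\<bar>z' - z\<bar> < min d1 d2" for X' z'
        using d(3)[OF L2_unit_diff[OF that(1) X], of z'] that by simp
      then show "?A e"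
        using d(1,2) by (intro exI[of _ "min d1 d2"]) auto
    qed
    then show ?thesis
      by (simp add: tendsto_iff dist_real_def case_prod_unfold)
  qed
  show ?thesis
    unfolding has_lions_derivative_def
    by (auto simp: joint smallo_def eventually_small_L2 L2_norm_unit_nonneg)
qed

lemma lions_derivative_L2:
  "has_lions_derivative v p \<Longrightarrow> X \<in> L2_unit \<Longrightarrow> (\<lambda>\<omega>. p (law X) (X \<omega>)) \<in> L2_unit"
  by (simp add: has_lions_derivative_iff)

lemma lions_derivative_remainder_smallo:
  "has_lions_derivative v p \<Longrightarrow> X \<in> L2_unit \<Longrightarrow>
    (\<lambda>H. v (law (\<lambda>\<omega>. X \<omega> + H \<omega>)) - v (law X) - (\<integral>\<omega>. p (law X) (X \<omega>) * H \<omega> \<partial>unit_space))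
      \<in> o[small_L2](L2_norm_unit)"
  by (simp add: has_lions_derivative_iff)

lemma L2_unit_inner_bigo:
  assumes "P \<in> L2_unit"
  shows "(\<lambda>H. \<integral>\<omega>. P \<omega> * H \<omega> \<partial>unit_space) \<in> O[small_L2](L2_norm_unit)"
  using small_L2_in_L2
  by (intro bigoI[of _ "L2_norm_unit P"], elim eventually_mono)
    (simp add: L2_unit_Cauchy_Schwarz assms L2_norm_unit_nonneg)

text \<open>The gradient is bounded by the Cauchy-Schwarz inequality and the remainder is of smaller order.
  This local Lipschitz bound controls the second-order terms in the product and chain rules, and
  yields continuity.\<close>

lemma lions_derivative_increment_bigo:
  assumes v: "has_lions_derivative v p" and X: "X \<in> L2_unit"
  shows "(\<lambda>H. v (law (\<lambda>\<omega>. X \<omega> + H \<omega>)) - v (law X)) \<in> O[small_L2](L2_norm_unit)"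
proof -
  let ?I = "\<lambda>H. \<integral>\<omega>. p (law X) (X \<omega>) * H \<omega> \<partial>unit_space"
  have "(\<lambda>H. v (law (\<lambda>\<omega>. X \<omega> + H \<omega>)) - v (law X) - ?I H) \<in> O[small_L2](L2_norm_unit)"
    using v X by (intro landau_o.small_imp_big lions_derivative_remainder_smallo)
  from sum_in_bigo(1)[OF this L2_unit_inner_bigo[OF lions_derivative_L2[OF v X]]]
  show ?thesis by simp
qed

lemma lions_derivative_continuous:
  assumes v: "has_lions_derivative v p" and X: "X \<in> L2_unit"
  shows "((\<lambda>H. v (law (\<lambda>\<omega>. X \<omega> + H \<omega>))) \<longlongrightarrow> v (law X)) small_L2"
proof -
  obtain c where c: "eventually (\<lambda>H. norm (v (law (\<lambda>\<omega>. X \<omega> + H \<omega>)) - v (law X)) \<le> c * norm (L2_norm_unit H)) small_L2"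
    using lions_derivative_increment_bigo[OF v X] by (auto elim: landau_o.bigE)
  have "((\<lambda>H. c * norm (L2_norm_unit H)) \<longlongrightarrow> 0) small_L2"
    by (rule tendsto_eq_intros L2_norm_small_L2 refl)+ simp
  from Lim_null_comparison[OF c this] show ?thesis
    by (simp add: LIM_zero_iff)
qed

lemma lions_derivative_tendsto_prod:
  assumes "has_lions_derivative v p" "X \<in> L2_unit"
  shows "((\<lambda>(H, z'). v (law (\<lambda>\<omega>. X \<omega> + H \<omega>))) \<longlongrightarrow> v (law X)) (small_L2 \<times>\<^sub>F nhds z)"
    and "((\<lambda>(H, z'). p (law (\<lambda>\<omega>. X \<omega> + H \<omega>)) z') \<longlongrightarrow> p (law X) z) (small_L2 \<times>\<^sub>F nhds z)"
  using filterlim_compose[OF lions_derivative_continuous[OF assms] filterlim_fst] assms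
  by (auto simp: case_prod_unfold has_lions_derivative_iff)

lemma has_lions_derivative_diff:
  assumes v: "has_lions_derivative v p" and w: "has_lions_derivative w q"
  shows "has_lions_derivative (\<lambda>m. v m - w m) (\<lambda>m z. p m z - q m z)"
  unfolding has_lions_derivative_iff
proof (intro ballI conjI allI)
  fix X z assume X: "X \<in> L2_unit"
  let ?P = "\<lambda>\<omega>. p (law X) (X \<omega>)" and ?Q = "\<lambda>\<omega>. q (law X) (X \<omega>)"
  have P: "?P \<in> L2_unit" and Q: "?Q \<in> L2_unit"
    using v w X by (auto intro: lions_derivative_L2)
  show "(\<lambda>\<omega>. ?P \<omega> - ?Q \<omega>) \<in> L2_unit"
    by (intro L2_unit_diff P Q)
  show "((\<lambda>(H, z'). p (law (\<lambda>\<omega>. X \<omega> + H \<omega>)) z' - q (law (\<lambda>\<omega>. X \<omega> + H \<omega>)) z')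
      \<longlongrightarrow> p (law X) z - q (law X) z) (small_L2 \<times>\<^sub>F nhds z)"
    using tendsto_diff[OF lions_derivative_tendsto_prod(2)[OF v X] lions_derivative_tendsto_prod(2)[OF w X]]
    by (simp add: case_prod_unfold)
  have "(\<lambda>H. (v (law (\<lambda>\<omega>. X \<omega> + H \<omega>)) - v (law X) - (\<integral>\<omega>. ?P \<omega> * H \<omega> \<partial>unit_space))
      - (w (law (\<lambda>\<omega>. X \<omega> + H \<omega>)) - w (law X) - (\<integral>\<omega>. ?Q \<omega> * H \<omega> \<partial>unit_space)))
    \<in> o[small_L2](L2_norm_unit)" (is "?L \<in> _")
    using lions_derivative_remainder_smallo[OF v X] lions_derivative_remainder_smallo[OF w X]
    by (rule sum_in_smallo(2))
  moreover have "eventually (\<lambda>H. ?L H = (v (law (\<lambda>\<omega>. X \<omega> + H \<omega>)) - w (law (\<lambda>\<omega>. X \<omega> + H \<omega>)))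
      - (v (law X) - w (law X)) - (\<integral>\<omega>. (?P \<omega> - ?Q \<omega>) * H \<omega> \<partial>unit_space)) small_L2"
    using small_L2_in_L2
    by eventually_elim (simp add: left_diff_distrib L2_unit_mult_integrable P Q)
  ultimately show "(\<lambda>H. (v (law (\<lambda>\<omega>. X \<omega> + H \<omega>)) - w (law (\<lambda>\<omega>. X \<omega> + H \<omega>))) - (v (law X) - w (law X))
      - (\<integral>\<omega>. (?P \<omega> - ?Q \<omega>) * H \<omega> \<partial>unit_space)) \<in> o[small_L2](L2_norm_unit)"
    by (simp only: landau_o.small.in_cong)
qed

text \<open>The increment of the product splits into \<open>v\<close> times the increment of \<open>w\<close>, \<open>w\<close> times the increment
  of \<open>v\<close>, and the product of the two increments, which is of order \<open>o(1) O(\<parallel>H\<parallel>)\<close>.\<close>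

lemma has_lions_derivative_mult:
  assumes v: "has_lions_derivative v p" and w: "has_lions_derivative w q"
  shows "has_lions_derivative (\<lambda>m. v m * w m) (\<lambda>m z. v m * q m z + w m * p m z)"
  unfolding has_lions_derivative_iff
proof (intro ballI conjI allI)
  fix X z assume X: "X \<in> L2_unit"
  let ?P = "\<lambda>\<omega>. p (law X) (X \<omega>)" and ?Q = "\<lambda>\<omega>. q (law X) (X \<omega>)"
  let ?v = "\<lambda>H. v (law (\<lambda>\<omega>. X \<omega> + H \<omega>))" and ?w = "\<lambda>H. w (law (\<lambda>\<omega>. X \<omega> + H \<omega>))"
  let ?R = "\<lambda>H. ?v H - v (law X) - (\<integral>\<omega>. ?P \<omega> * H \<omega> \<partial>unit_space)"
  let ?S = "\<lambda>H. ?w H - w (law X) - (\<integral>\<omega>. ?Q \<omega> * H \<omega> \<partial>unit_space)"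
  have P: "?P \<in> L2_unit" and Q: "?Q \<in> L2_unit"
    using v w X by (auto intro: lions_derivative_L2)
  show "(\<lambda>\<omega>. v (law X) * ?Q \<omega> + w (law X) * ?P \<omega>) \<in> L2_unit"
    by (intro L2_unit_add L2_unit_scale P Q)
  show "((\<lambda>(H, z'). ?v H * q (law (\<lambda>\<omega>. X \<omega> + H \<omega>)) z' + ?w H * p (law (\<lambda>\<omega>. X \<omega> + H \<omega>)) z')
      \<longlongrightarrow> v (law X) * q (law X) z + w (law X) * p (law X) z) (small_L2 \<times>\<^sub>F nhds z)"
    using tendsto_add[OF tendsto_mult[OF lions_derivative_tendsto_prod(1)[OF v X]
          lions_derivative_tendsto_prod(2)[OF w X]]
        tendsto_mult[OF lions_derivative_tendsto_prod(1)[OF w X]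
          lions_derivative_tendsto_prod(2)[OF v X]]]
    by (simp add: case_prod_unfold)
  have R: "?R \<in> o[small_L2](L2_norm_unit)" and S: "?S \<in> o[small_L2](L2_norm_unit)"
    using lions_derivative_remainder_smallo[OF v X] lions_derivative_remainder_smallo[OF w X] by simp_all
  have "(\<lambda>H. ?v H - v (law X)) \<in> o[small_L2](\<lambda>_. 1)"
    using LIM_zero[OF lions_derivative_continuous[OF v X]] by (intro smalloI_tendsto) auto
  from landau_o.small_big_mult[OF this lions_derivative_increment_bigo[OF w X]]
  have "(\<lambda>H. (?v H - v (law X)) * (?w H - w (law X))) \<in> o[small_L2](L2_norm_unit)"
    by simp
  then have "(\<lambda>H. v (law X) * ?S H + w (law X) * ?R H + (?v H - v (law X)) * (?w H - w (law X)))
      \<in> o[small_L2](L2_norm_unit)" (is "?L \<in> _")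
    using R S by (intro sum_in_smallo) auto
  moreover have "eventually (\<lambda>H. ?L H = ?v H * ?w H - v (law X) * w (law X)
      - (\<integral>\<omega>. (v (law X) * ?Q \<omega> + w (law X) * ?P \<omega>) * H \<omega> \<partial>unit_space)) small_L2"
    using small_L2_in_L2
    by eventually_elim
      (simp add: distrib_right mult.assoc L2_unit_mult_integrable P Q, simp add: algebra_simps)
  ultimately show "(\<lambda>H. ?v H * ?w H - v (law X) * w (law X)
      - (\<integral>\<omega>. (v (law X) * ?Q \<omega> + w (law X) * ?P \<omega>) * H \<omega> \<partial>unit_space)) \<in> o[small_L2](L2_norm_unit)"
    by (simp only: landau_o.small.in_cong)
qed

text \<open>The remainder is \<open>\<phi>'(v)\<close> times that of \<open>v\<close>, plus the Taylor remainder of \<open>\<phi>\<close> at the increment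
  of \<open>v\<close>; the latter is \<open>o(\<parallel>H\<parallel>)\<close> because that increment is \<open>O(\<parallel>H\<parallel>)\<close>. Continuity of \<open>\<phi>'\<close> is
  what carries over the joint continuity of the derivative.\<close>

lemma has_lions_derivative_compose:
  assumes v: "has_lions_derivative v p"
    and \<phi>: "\<And>s. (\<phi> has_real_derivative \<phi>' s) (at s)"
    and cont: "continuous_on UNIV \<phi>'"
  shows "has_lions_derivative (\<lambda>m. \<phi> (v m)) (\<lambda>m z. \<phi>' (v m) * p m z)"
  unfolding has_lions_derivative_iff
proof (intro ballI conjI allI)
  fix X z assume X: "X \<in> L2_unit"
  let ?P = "\<lambda>\<omega>. p (law X) (X \<omega>)" and ?v = "\<lambda>H. v (law (\<lambda>\<omega>. X \<omega> + H \<omega>))"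
  let ?R = "\<lambda>H. ?v H - v (law X) - (\<integral>\<omega>. ?P \<omega> * H \<omega> \<partial>unit_space)"
  have P: "?P \<in> L2_unit"
    using v X by (auto intro: lions_derivative_L2)
  show "(\<lambda>\<omega>. \<phi>' (v (law X)) * ?P \<omega>) \<in> L2_unit"
    by (intro L2_unit_scale P)
  have "isCont \<phi>' (v (law X))"
    using cont by (simp add: continuous_on_eq_continuous_at)
  from tendsto_mult[OF isCont_tendsto_compose[OF this lions_derivative_tendsto_prod(1)[OF v X]]
      lions_derivative_tendsto_prod(2)[OF v X]]
  show "((\<lambda>(H, z'). \<phi>' (?v H) * p (law (\<lambda>\<omega>. X \<omega> + H \<omega>)) z')
      \<longlongrightarrow> \<phi>' (v (law X)) * p (law X) z) (small_L2 \<times>\<^sub>F nhds z)"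
    by (simp add: case_prod_unfold)
  have R: "?R \<in> o[small_L2](L2_norm_unit)"
    using v X by (rule lions_derivative_remainder_smallo)
  have "(\<lambda>s. \<phi> s - \<phi> (v (law X)) - \<phi>' (v (law X)) * (s - v (law X)))
      \<in> o[nhds (v (law X))](\<lambda>s. s - v (law X))"
    using \<phi>[of "v (law X)"]
    unfolding has_field_derivative_def has_derivative_at_alt smallo_def eventually_nhds_metric dist_norm
    by simp
  from landau_o.small.compose[OF this lions_derivative_continuous[OF v X]]
  have "(\<lambda>H. \<phi> (?v H) - \<phi> (v (law X)) - \<phi>' (v (law X)) * (?v H - v (law X)))
      \<in> o[small_L2](L2_norm_unit)"
    using lions_derivative_increment_bigo[OF v X] by (rule landau_o.small_big_trans)
  then have "(\<lambda>H. \<phi> (?v H) - \<phi> (v (law X)) - \<phi>' (v (law X)) * (?v H - v (law X)) + \<phi>' (v (law X)) * ?R H)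
      \<in> o[small_L2](L2_norm_unit)" (is "?L \<in> _")
    using R by (intro sum_in_smallo(1)) auto
  moreover have "?L = (\<lambda>H. \<phi> (?v H) - \<phi> (v (law X)) - (\<integral>\<omega>. \<phi>' (v (law X)) * ?P \<omega> * H \<omega> \<partial>unit_space))"
    by (auto simp: fun_eq_iff right_diff_distrib mult.assoc)
  ultimately show "(\<lambda>H. \<phi> (?v H) - \<phi> (v (law X))
      - (\<integral>\<omega>. \<phi>' (v (law X)) * ?P \<omega> * H \<omega> \<partial>unit_space)) \<in> o[small_L2](L2_norm_unit)"
    by simp
qed

section \<open>Partial derivatives and product integrals\<close>

text \<open>Differentiability of \<open>g\<close> in both variables together follows from the existence of one partial
  derivative at the point and the continuity of the other. The derivative in \<open>s\<close> is taken within
  \<open>S\<close>, so the rule covers one-sided time derivatives at the endpoints.\<close>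

lemma has_real_derivative_moving_argument:
  fixes g gx :: "real \<Rightarrow> real \<Rightarrow> real"
  assumes gx: "\<And>\<xi> s. s \<in> S \<Longrightarrow> ((\<lambda>\<xi>. g \<xi> s) has_real_derivative gx \<xi> s) (at \<xi>)"
    and cont: "continuous_on (UNIV \<times> S) (\<lambda>(\<xi>, s). gx \<xi> s)"
    and gs: "((\<lambda>s. g (h t) s) has_real_derivative gt) (at t within S)"
    and h: "(h has_real_derivative h') (at t within S)"
    and t: "t \<in> S"
  shows "((\<lambda>s. g (h s) s) has_real_derivative gx (h t) t * h' + gt) (at t within S)"
proof -
  have "((\<lambda>(s, \<xi>). g \<xi> s) has_derivative (\<lambda>(ds, d\<xi>). gt * ds + blinfun_mult_right (gx (h t) t) d\<xi>))
      (at (t, h t) within S \<times> UNIV)"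
  proof (rule has_derivative_partialsI)
    show "((\<lambda>s. g (h t) s) has_derivative (\<lambda>ds. gt * ds)) (at t within S)"
      using gs by (simp add: has_field_derivative_def)
    show "((\<lambda>\<xi>. g \<xi> s) has_derivative blinfun_mult_right (gx \<xi> s)) (at \<xi> within UNIV)"
      if "s \<in> S" for s \<xi>
      using gx[OF that] by (simp add: has_field_derivative_def)
    have "continuous_on (S \<times> UNIV) (\<lambda>p. (\<lambda>(\<xi>, s). gx \<xi> s) (prod.swap p))"
      by (rule continuous_on_compose2[OF cont]) (auto intro: continuous_on_swap)
    then have "continuous (at (t, h t) within S \<times> UNIV) (\<lambda>p. gx (snd p) (fst p))"
      using t by (simp add: continuous_on_eq_continuous_within case_prod_unfold)
    from bounded_linear.continuous[OF bounded_linear_blinfun_mult_right this]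
    show "continuous (at (t, h t) within S \<times> UNIV) (\<lambda>(s, \<xi>). blinfun_mult_right (gx \<xi> s))"
      by (simp add: case_prod_unfold)
  qed auto
  then have "((\<lambda>(s, \<xi>). g \<xi> s) has_derivative (\<lambda>(ds, d\<xi>). gt * ds + gx (h t) t * d\<xi>))
      (at (t, h t) within (\<lambda>s. (s, h s)) ` S)"
    unfolding blinfun_mult_right.rep_eq by (rule has_derivative_subset) auto
  moreover have "((\<lambda>s. (s, h s)) has_derivative (\<lambda>ds. (ds, h' * ds))) (at t within S)"
    using h unfolding has_field_derivative_def by (intro has_derivative_Pair has_derivative_ident)
  ultimately have "((\<lambda>s. g (h s) s) has_derivative (\<lambda>ds. gt * ds + gx (h t) t * (h' * ds))) (at t within S)"
    by (auto dest: has_derivative_in_compose[rotated])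
  then show ?thesis
    by (rule has_derivative_imp_has_field_derivative) (simp add: algebra_simps)
qed

text \<open>The mixed second difference of \<open>g\<close> over a square of side \<open>h\<close> equals \<open>h\<^sup>2\<close> times a value of either
  mixed partial derivative inside the square, by the mean value theorem applied twice in either
  order. Letting the square shrink to its corner, continuity identifies the two.\<close>

lemma mixed_partials_commute:
  fixes g gx gy gxy gyx :: "real \<Rightarrow> real \<Rightarrow> real"
  assumes gx: "\<And>x y. ((\<lambda>\<xi>. g \<xi> y) has_real_derivative gx x y) (at x)"
    and gy: "\<And>x y. ((\<lambda>\<eta>. g x \<eta>) has_real_derivative gy x y) (at y)"
    and gxy: "\<And>x y. ((\<lambda>\<eta>. gx x \<eta>) has_real_derivative gxy x y) (at y)"
    and gyx: "\<And>x y. ((\<lambda>\<xi>. gy \<xi> y) has_real_derivative gyx x y) (at x)"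
    and cont: "isCont (\<lambda>(x, y). gxy x y) (x0, y0)" "isCont (\<lambda>(x, y). gyx x y) (x0, y0)"
  shows "gxy x0 y0 = gyx x0 y0"
proof -
  have mean: "\<exists>\<xi> \<eta> \<xi>' \<eta>'. {\<xi>, \<xi>'} \<subseteq> {x0<..<x0 + h} \<and> {\<eta>, \<eta>'} \<subseteq> {y0<..<y0 + h} \<and> gxy \<xi> \<eta> = gyx \<xi>' \<eta>'"
    if h: "h > 0" for h
  proof -
    let ?\<Delta> = "g (x0 + h) (y0 + h) - g x0 (y0 + h) - g (x0 + h) y0 + g x0 y0"
    have "((\<lambda>\<xi>. g \<xi> (y0 + h) - g \<xi> y0) has_real_derivative gx x (y0 + h) - gx x y0) (at x)" for x
      by (intro DERIV_diff gx)
    then obtain \<xi> where \<xi>: "x0 < \<xi>" "\<xi> < x0 + h" "?\<Delta> = h * (gx \<xi> (y0 + h) - gx \<xi> y0)"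
      using MVT2[of x0 "x0 + h" "\<lambda>\<xi>. g \<xi> (y0 + h) - g \<xi> y0" "\<lambda>x. gx x (y0 + h) - gx x y0"] h
      by (auto simp: algebra_simps)
    obtain \<eta> where \<eta>: "y0 < \<eta>" "\<eta> < y0 + h" "gx \<xi> (y0 + h) - gx \<xi> y0 = h * gxy \<xi> \<eta>"
      using MVT2[of y0 "y0 + h" "gx \<xi>" "gxy \<xi>"] h gxy by auto
    have "((\<lambda>\<eta>. g (x0 + h) \<eta> - g x0 \<eta>) has_real_derivative gy (x0 + h) y - gy x0 y) (at y)" for y
      by (intro DERIV_diff gy)
    then obtain \<eta>' where \<eta>': "y0 < \<eta>'" "\<eta>' < y0 + h" "?\<Delta> = h * (gy (x0 + h) \<eta>' - gy x0 \<eta>')"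
      using MVT2[of y0 "y0 + h" "\<lambda>\<eta>. g (x0 + h) \<eta> - g x0 \<eta>" "\<lambda>y. gy (x0 + h) y - gy x0 y"] h
      by (auto simp: algebra_simps)
    obtain \<xi>' where \<xi>': "x0 < \<xi>'" "\<xi>' < x0 + h" "gy (x0 + h) \<eta>' - gy x0 \<eta>' = h * gyx \<xi>' \<eta>'"
      using MVT2[of x0 "x0 + h" "\<lambda>x. gy x \<eta>'" "\<lambda>x. gyx x \<eta>'"] h gyx by auto
    have "h * (h * gxy \<xi> \<eta>) = h * (h * gyx \<xi>' \<eta>')"
      using \<xi>(3) \<eta>(3) \<eta>'(3) \<xi>'(3) by metis
    then have "gxy \<xi> \<eta> = gyx \<xi>' \<eta>'"
      using h by simp
    then show ?thesis
      using \<xi> \<eta> \<xi>' \<eta>' by force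
  qed
  have "\<bar>gxy x0 y0 - gyx x0 y0\<bar> < e" if e: "e > 0" for e
  proof -
    obtain d1 where d1: "d1 > 0" "\<And>x y. dist (x, y) (x0, y0) < d1 \<Longrightarrow> dist (gxy x y) (gxy x0 y0) < e / 2"
      using cont(1) e unfolding continuous_at_eps_delta by (force dest: spec[of _ "e / 2"])
    obtain d2 where d2: "d2 > 0" "\<And>x y. dist (x, y) (x0, y0) < d2 \<Longrightarrow> dist (gyx x y) (gyx x0 y0) < e / 2"
      using cont(2) e unfolding continuous_at_eps_delta by (force dest: spec[of _ "e / 2"])
    define h where "h = min d1 d2 / 2"
    have near: "dist (x, y) (x0, y0) < min d1 d2" if "x \<in> {x0<..<x0 + h}" "y \<in> {y0<..<y0 + h}" for x y
    proof -
      have "dist (x, y) (x0, y0) \<le> \<bar>x - x0\<bar> + \<bar>y - y0\<bar>"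
        by (simp add: dist_prod_def dist_real_def sqrt_sum_squares_le_sum_abs)
      then show ?thesis using that by (auto simp: h_def)
    qed
    obtain \<xi> \<eta> \<xi>' \<eta>' where "\<xi> \<in> {x0<..<x0 + h}" "\<xi>' \<in> {x0<..<x0 + h}" "\<eta> \<in> {y0<..<y0 + h}"
      "\<eta>' \<in> {y0<..<y0 + h}" and eq: "gxy \<xi> \<eta> = gyx \<xi>' \<eta>'"
      using mean[of h] d1(1) d2(1) by (auto simp: h_def)
    then have "dist (gxy \<xi> \<eta>) (gxy x0 y0) < e / 2" "dist (gyx \<xi>' \<eta>') (gyx x0 y0) < e / 2"
      using near by (intro d1(2) d2(2); force)+
    then show ?thesis
      using eq unfolding dist_real_def by arith
  qed
  from this[of "\<bar>gxy x0 y0 - gyx x0 y0\<bar>"] show ?thesis by auto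
qed

lemma (in sigma_finite_measure) integral_pair_mult:
  fixes g h :: "'a \<Rightarrow> real"
  assumes g: "integrable M g" and h: "integrable M h"
  shows "integrable (M \<Otimes>\<^sub>M M) (\<lambda>(z1, z2). g z1 * h z2)"
    and "(\<integral>(z1, z2). g z1 * h z2 \<partial>(M \<Otimes>\<^sub>M M)) = (\<integral>z. g z \<partial>M) * (\<integral>z. h z \<partial>M)"
proof -
  interpret P: pair_sigma_finite M M ..
  have [measurable]: "g \<in> borel_measurable M" "h \<in> borel_measurable M"
    using g h by auto
  show int: "integrable (M \<Otimes>\<^sub>M M) (\<lambda>(z1, z2). g z1 * h z2)"
    using g h by (intro P.Fubini_integrable) (auto simp: abs_mult)
  have "(\<integral>z1. \<integral>z2. g z1 * h z2 \<partial>M \<partial>M) = (\<integral>(z1, z2). g z1 * h z2 \<partial>(M \<Otimes>\<^sub>M M))"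
    using P.integral_fst'[OF int] by simp
  then show "(\<integral>(z1, z2). g z1 * h z2 \<partial>(M \<Otimes>\<^sub>M M)) = (\<integral>z. g z \<partial>M) * (\<integral>z. h z \<partial>M)"
    by simp
qed

section \<open>The master equation\<close>

text \<open>The calculus rules give a function and its derivative in the form dictated by the rule; this
  replaces both by equal expressions.\<close>

lemma has_lions_derivative_cong:
  assumes "has_lions_derivative v p" "\<And>m. v m = v' m" "\<And>m z. p m z = p' m z"
  shows "has_lions_derivative v' p'"
proof -
  have "v = v'" "p = p'"
    using assms(2,3) by (auto simp: fun_eq_iff)
  then show ?thesis using assms(1) by simp
qed

lemma continuous_on_slices:
  fixes g :: "real \<Rightarrow> real \<Rightarrow> real \<Rightarrow> real"
  assumes g: "continuous_on (UNIV \<times> UNIV \<times> {0..T}) (\<lambda>(x, y, t). g x y t)"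
  shows "continuous_on (UNIV \<times> {0..T}) (\<lambda>(\<xi>, s). g \<xi> y s)"
    and "t \<in> {0..T} \<Longrightarrow> continuous_on (UNIV \<times> UNIV) (\<lambda>(\<xi>, \<eta>). g \<xi> \<eta> t)"
    and "t \<in> {0..T} \<Longrightarrow> continuous_on UNIV (\<lambda>\<xi>. g \<xi> y t)"
proof -
  have *: "continuous_on A (\<lambda>p. g (\<alpha> p) (\<beta> p) (\<tau> p))"
    if "continuous_on A \<alpha>" "continuous_on A \<beta>" "continuous_on A \<tau>" "\<tau> ` A \<subseteq> {0..T}"
    for A :: "'c::topological_space set" and \<alpha> \<beta> \<tau> :: "'c \<Rightarrow> real"
    using continuous_on_compose2[OF g continuous_on_Pair[OF that(1) continuous_on_Pair[OF that(2,3)]]]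
      that(4) by auto
  show "continuous_on (UNIV \<times> {0..T}) (\<lambda>(\<xi>, s). g \<xi> y s)"
    unfolding case_prod_unfold by (rule *) (auto intro!: continuous_intros)
  show "continuous_on (UNIV \<times> UNIV) (\<lambda>(\<xi>, \<eta>). g \<xi> \<eta> t)" if "t \<in> {0..T}"
    unfolding case_prod_unfold using that by (intro *) (auto intro!: continuous_intros)
  show "continuous_on UNIV (\<lambda>\<xi>. g \<xi> y t)" if "t \<in> {0..T}"
    using that by (intro *) (auto intro!: continuous_intros)
qed

text \<open>Here \<open>i\<close>, \<open>l2\<close> and \<open>l4\<close> are the values at \<open>f\<close> of the third, the second and the fourth operator, and
  \<open>q\<close> in the proof is the optimal feedback.\<close>

lemma master_equation_algebra:
  fixes ux uxx :: real
  assumes "uxx \<noteq> 0"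
    and hjb: "ut - (b * ux + uxy)\<^sup>2 / (2 * uxx) + 1/2 * uyy + b * uy = 0"
    and f: "ft + l2 + l4 + 1/2 * fyy = 0"
    and p: "p - i = fy + - (b * ux + uxy) / uxx"
  shows "(ut - ux * ft) + 1/2 * p\<^sup>2 * uxx + p * (b * ux + (uxy - uxx * fy)) + p * (- uxx * i)
      + (1/2 * uxx * i\<^sup>2 - ux * l2) + b * (- ux * i) + (- uxy * i + uxx * fy * i - ux * l4)
      + 1/2 * (uyy - 2 * uxy * fy + uxx * fy\<^sup>2 - ux * fyy) + b * (uy - ux * fy) = 0"
    (is "?L = 0")
proof -
  define q where "q = p - i - fy"
  have q: "uxx * q = - (b * ux + uxy)"
    using p \<open>uxx \<noteq> 0\<close> by (simp add: q_def)
  have "?L = ut + 1/2 * uyy + b * uy - ux * (ft + l2 + l4 + 1/2 * fyy) + (b * ux + uxy) * q + 1/2 * (uxx * q) * q"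
    by (simp add: q_def field_simps power2_eq_square)
  also have "\<dots> = ut + 1/2 * uyy + b * uy + 1/2 * (b * ux + uxy) * q"
    unfolding f q by (simp add: field_simps)
  also have "q = - (b * ux + uxy) / uxx"
    using q \<open>uxx \<noteq> 0\<close> by (simp add: field_simps)
  also have "ut + 1/2 * uyy + b * uy + 1/2 * (b * ux + uxy) * (- (b * ux + uxy) / uxx) = 0"
    using hjb \<open>uxx \<noteq> 0\<close> by (simp add: field_simps power2_eq_square)
  finally show ?thesis .
qed

text \<open>For \<open>c = u_xx\<close> and \<open>d = u_x\<close> the arguments are \<open>U_mm\<close> and \<open>U_mz\<close>. The term with \<open>c\<close> separates in
  \<open>z1\<close> and \<open>z2\<close>, so its double integral is the square of a single one; this also gives its
  integrability.\<close>

lemma L2_composition: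
  fixes \<pi> :: "real \<Rightarrow> real \<Rightarrow> real measure \<Rightarrow> real \<Rightarrow> real" and fm fmz :: "real \<Rightarrow> real"
    and fmm :: "real \<Rightarrow> real \<Rightarrow> real"
  assumes m: "sigma_finite_measure m" and fm: "integrable m (\<lambda>z. \<pi> z y m t * fm z)"
    and L2f: "L2_defined \<pi> y m t fmm fmz"
  shows "L2_defined \<pi> y m t (\<lambda>z1 z2. c * fm z1 * fm z2 - d * fmm z1 z2) (\<lambda>z. - d * fmz z)"
    and "L2 \<pi> y m t (\<lambda>z1 z2. c * fm z1 * fm z2 - d * fmm z1 z2) (\<lambda>z. - d * fmz z)
      = 1/2 * c * (\<integral>z. \<pi> z y m t * fm z \<partial>m)\<^sup>2 - d * L2 \<pi> y m t fmm fmz"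
proof -
  interpret sigma_finite_measure m by (fact m)
  let ?h = "\<lambda>z. \<pi> z y m t * fm z"
  let ?k = "\<lambda>(z1, z2). \<pi> z1 y m t * \<pi> z2 y m t * fmm z1 z2"
  have int: "integrable (m \<Otimes>\<^sub>M m) (\<lambda>(z1, z2). ?h z1 * ?h z2)" "integrable (m \<Otimes>\<^sub>M m) ?k"
    "integrable m (\<lambda>z. (\<pi> z y m t)\<^sup>2 * fmz z)"
    using integral_pair_mult(1)[OF fm fm] L2f by (auto simp: L2_defined_def)
  have mm: "(\<lambda>(z1, z2). \<pi> z1 y m t * \<pi> z2 y m t * (c * fm z1 * fm z2 - d * fmm z1 z2))
      = (\<lambda>p. c * (case p of (z1, z2) \<Rightarrow> ?h z1 * ?h z2) - d * ?k p)"
    by (auto simp: fun_eq_iff algebra_simps)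
  have mz: "(\<lambda>z. (\<pi> z y m t)\<^sup>2 * (- d * fmz z)) = (\<lambda>z. - d * ((\<pi> z y m t)\<^sup>2 * fmz z))"
    by (auto simp: fun_eq_iff)
  show "L2_defined \<pi> y m t (\<lambda>z1 z2. c * fm z1 * fm z2 - d * fmm z1 z2) (\<lambda>z. - d * fmz z)"
    unfolding L2_defined_def mm mz using int by simp
  have "(\<integral>p. c * (case p of (z1, z2) \<Rightarrow> ?h z1 * ?h z2) - d * ?k p \<partial>(m \<Otimes>\<^sub>M m))
      = c * (\<integral>z. ?h z \<partial>m)\<^sup>2 - d * (\<integral>p. ?k p \<partial>(m \<Otimes>\<^sub>M m))"
    using int(1,2) integral_pair_mult(2)[OF fm fm] by (simp add: power2_eq_square)
  then show "L2 \<pi> y m t (\<lambda>z1 z2. c * fm z1 * fm z2 - d * fmm z1 z2) (\<lambda>z. - d * fmz z)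
      = 1/2 * c * (\<integral>z. ?h z \<partial>m)\<^sup>2 - d * L2 \<pi> y m t fmm fmz"
    unfolding L2_def mm mz by (simp add: algebra_simps)
qed

theorem proposition11:
  fixes M :: "'w measure" and W :: "real \<Rightarrow> 'w \<Rightarrow> real"
    and Y :: "real \<Rightarrow> real \<Rightarrow> real \<Rightarrow> 'w \<Rightarrow> real"
    and T \<theta>1 \<theta>2 :: real and \<nu> :: "real measure"
    and b :: "real \<Rightarrow> real \<Rightarrow> real" and J :: "real \<Rightarrow> real"
    and u ux uy uxx uxy uyx uyy ut a :: "real \<Rightarrow> real \<Rightarrow> real \<Rightarrow> real"
    and C :: "real measure \<Rightarrow> real"
    and f ft fy fyy :: "real \<Rightarrow> real measure \<Rightarrow> real \<Rightarrow> real"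
    and fm fmz fym :: "real \<Rightarrow> real measure \<Rightarrow> real \<Rightarrow> real \<Rightarrow> real"
    and fmm :: "real \<Rightarrow> real measure \<Rightarrow> real \<Rightarrow> real \<Rightarrow> real \<Rightarrow> real"
    and \<pi> :: "real \<Rightarrow> real \<Rightarrow> real measure \<Rightarrow> real \<Rightarrow> real"
  assumes T: "0 < T"
    and prior: "0 < \<theta>1" "\<theta>1 < \<theta>2" "prior_on \<theta>1 \<theta>2 \<nu>"
    and b: "b = drift \<theta>1 \<theta>2 \<nu>"
    and W: "brownian_motion M W"
    and Y: "\<forall>y. \<forall>t\<in>{0..T}. solves_sde M W b T t y (Y t y)"
    and J: "utility J"
    and u: "is_value_function M W b J T Y u"
    and u_mono: "\<forall>y. \<forall>t\<in>{0..T}. strict_mono (\<lambda>x. u x y t)"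
    and u_concave: "\<forall>y. \<forall>t\<in>{0..T}. strictly_concave (\<lambda>x. u x y t)"
    and u_smooth: "C221 T u ux uy uxx uxy uyx uyy ut"
    and u_hjb: "hjb_solution T b J u ux uy uxx uxy uyy ut"
    and a: "a = optimal_feedback b ux uxx uxy"
    and C: "\<forall>m\<in>P2. 0 < C m"
    and f: "f_solution T C \<pi> f ft fy fyy fm fmm fmz fym"
    and \<pi>: "pi_relation T a f fy fm \<pi>"
  shows "master_solution T b J C \<pi> (\<lambda>x y m t. u (x - f y m t) y t)"
proof -
  let ?S = "UNIV \<times> UNIV \<times> {0..T} :: (real \<times> real \<times> real) set"
  have du: "((\<lambda>\<xi>. u \<xi> y t) has_real_derivative ux x y t) (at x)"
    "((\<lambda>\<eta>. u x \<eta> t) has_real_derivative uy x y t) (at y)"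
    "((\<lambda>\<xi>. ux \<xi> y t) has_real_derivative uxx x y t) (at x)"
    "((\<lambda>\<eta>. ux x \<eta> t) has_real_derivative uxy x y t) (at y)"
    "((\<lambda>\<xi>. uy \<xi> y t) has_real_derivative uyx x y t) (at x)"
    "((\<lambda>\<eta>. uy x \<eta> t) has_real_derivative uyy x y t) (at y)"
    "((\<lambda>s. u x y s) has_real_derivative ut x y t) (at t within {0..T})"
    if "t \<in> {0..T}" for x y t
    using u_smooth that unfolding C221_def by blast+
  have cu: "continuous_on ?S (\<lambda>(x, y, t). u x y t)" "continuous_on ?S (\<lambda>(x, y, t). ux x y t)"
    "continuous_on ?S (\<lambda>(x, y, t). uxx x y t)" "continuous_on ?S (\<lambda>(x, y, t). uxy x y t)"
    "continuous_on ?S (\<lambda>(x, y, t). uyx x y t)"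
    using u_smooth unfolding C221_def by blast+
  have mixed: "uyx x y t = uxy x y t" if t: "t \<in> {0..T}" for x y t
  proof (rule mixed_partials_commute[symmetric, where g = "\<lambda>x y. u x y t" and gx = "\<lambda>x y. ux x y t"
        and gy = "\<lambda>x y. uy x y t" and gxy = "\<lambda>x y. uxy x y t" and gyx = "\<lambda>x y. uyx x y t"])
    show "isCont (\<lambda>(x, y). uxy x y t) (x, y)" "isCont (\<lambda>(x, y). uyx x y t) (x, y)"
      using continuous_on_slices(2)[OF cu(4) t] continuous_on_slices(2)[OF cu(5) t]
      by (simp_all add: continuous_on_eq_continuous_at)
  qed (rule du[OF t])+

  have fcont: "continuous_on {0..T} (\<lambda>t. f y m t)" if "m \<in> P2" for y m
    using f that unfolding f_solution_def by blast
  have fy: "((\<lambda>\<eta>. f \<eta> m t) has_real_derivative fy y m t) (at y)" if "m \<in> P2" "t \<in> {0..T}" for y m t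
    using f that unfolding f_solution_def by blast
  have fm: "has_lions_derivative (\<lambda>m. f y m t) (\<lambda>m z. fm y m z t)" if "t \<in> {0..T}" for y t
    using f that unfolding f_solution_def by blast
  have df: "((\<lambda>s. f y m s) has_real_derivative ft y m t) (at t within {0..T})"
    "((\<lambda>\<eta>. fy \<eta> m t) has_real_derivative fyy y m t) (at y)"
    "((\<lambda>\<zeta>. fm y m \<zeta> t) has_real_derivative fmz y m z t) (at z)"
    if "m \<in> P2" "t \<in> {0..<T}" for y m z t
    using f that unfolding f_solution_def by blast+
  have fym: "has_lions_derivative (\<lambda>m. fy y m t) (\<lambda>m z. fym y m z t)"
    and fmm: "has_lions_derivative (\<lambda>m. fm y m z1 t) (\<lambda>m z2. fmm y m z1 z2 t)"
    if "t \<in> {0..<T}" for y t z1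
    using f that unfolding f_solution_def by blast+
  have feq: "L2_defined \<pi> y m t (\<lambda>z1 z2. fmm y m z1 z2 t) (\<lambda>z. fmz y m z t)"
    "single_defined \<pi> y m t (\<lambda>z. fym y m z t)"
    "ft y m t + L2 \<pi> y m t (\<lambda>z1 z2. fmm y m z1 z2 t) (\<lambda>z. fmz y m z t)
      + L4 \<pi> y m t (\<lambda>z. fym y m z t) + 1/2 * fyy y m t = 0"
    if "m \<in> P2" "t \<in> {0..<T}" for y m t
    using f that unfolding f_solution_def by blast+
  have fT: "f y m T = C m" if "m \<in> P2" for y m
    using f that unfolding f_solution_def by blast

  (* The derivatives of U according to the chain rule. The derivative of uy in x is written as uxy,
     which the fact mixed justifies. *)
  define Ut where "Ut x y m t = ut (x - f y m t) y t - ux (x - f y m t) y t * ft y m t" for x y m t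
  define Ux where "Ux x y m t = ux (x - f y m t) y t" for x y m t
  define Uxx where "Uxx x y m t = uxx (x - f y m t) y t" for x y m t
  define Uxy where "Uxy x y m t = uxy (x - f y m t) y t - uxx (x - f y m t) y t * fy y m t" for x y m t
  define Uy where "Uy x y m t = uy (x - f y m t) y t - ux (x - f y m t) y t * fy y m t" for x y m t
  define Uyy where "Uyy x y m t = uyy (x - f y m t) y t - 2 * uxy (x - f y m t) y t * fy y m t
      + uxx (x - f y m t) y t * (fy y m t)\<^sup>2 - ux (x - f y m t) y t * fyy y m t" for x y m t
  define Um where "Um x y m z t = - ux (x - f y m t) y t * fm y m z t" for x y m z t
  define Umm where "Umm x y m z1 z2 t = uxx (x - f y m t) y t * fm y m z1 t * fm y m z2 t
      - ux (x - f y m t) y t * fmm y m z1 z2 t" for x y m z1 z2 t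
  define Umz where "Umz x y m z t = - ux (x - f y m t) y t * fmz y m z t" for x y m z t
  define Uxm where "Uxm x y m z t = - uxx (x - f y m t) y t * fm y m z t" for x y m z t
  define Uym where "Uym x y m z t = - uxy (x - f y m t) y t * fm y m z t
      + uxx (x - f y m t) y t * fy y m t * fm y m z t - ux (x - f y m t) y t * fym y m z t" for x y m z t

  have along_y: "((\<lambda>\<eta>. w (x - f \<eta> m t) \<eta> t) has_real_derivative
      wy (x - f y m t) y t - wx (x - f y m t) y t * fy y m t) (at y)"
    if "m \<in> P2" "t \<in> {0..T}"
      and "\<And>x y. ((\<lambda>\<xi>. w \<xi> y t) has_real_derivative wx x y t) (at x)"
      and "\<And>x y. ((\<lambda>\<eta>. w x \<eta> t) has_real_derivative wy x y t) (at y)"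
      and "continuous_on ?S (\<lambda>(x, y, t). wx x y t)"
    for w wx wy :: "real \<Rightarrow> real \<Rightarrow> real \<Rightarrow> real" and x y m t
  proof -
    have "((\<lambda>\<eta>. x - f \<eta> m t) has_real_derivative - fy y m t) (at y)"
      using DERIV_diff[OF DERIV_const fy[OF that(1,2)]] by simp
    from has_real_derivative_moving_argument[where S = UNIV and g = "\<lambda>\<xi> \<eta>. w \<xi> \<eta> t" and
        gx = "\<lambda>\<xi> \<eta>. wx \<xi> \<eta> t", OF that(3) continuous_on_slices(2)[OF that(5,2)] that(4) this UNIV_I]
    show ?thesis by (simp add: algebra_simps)
  qed
  have along_m: "has_lions_derivative (\<lambda>m. w (x - f y m t) y t)
      (\<lambda>m z. - wx (x - f y m t) y t * fm y m z t)"
    if "t \<in> {0..T}" and "\<And>x. ((\<lambda>\<xi>. w \<xi> y t) has_real_derivative wx x y t) (at x)"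
      and "continuous_on ?S (\<lambda>(x, y, t). wx x y t)"
    for w wx :: "real \<Rightarrow> real \<Rightarrow> real \<Rightarrow> real" and x y t
  proof (rule has_lions_derivative_compose[OF fm[OF that(1)]])
    show "((\<lambda>s. w (x - s) y t) has_real_derivative - wx (x - s) y t) (at s)" for s
      using DERIV_chain2[OF that(2) DERIV_diff[OF DERIV_const DERIV_ident], of x s] by simp
    show "continuous_on UNIV (\<lambda>s. - wx (x - s) y t)"
      by (intro continuous_intros continuous_on_compose2[OF continuous_on_slices(3)[OF that(3,1)]]) auto
  qed

  have U_cont: "\<forall>x y. \<forall>m\<in>P2. continuous_on {0..T} (\<lambda>t. u (x - f y m t) y t)"
  proof (intro allI ballI)
    fix x y m assume m: "m \<in> P2"
    have "continuous_on {0..T} (\<lambda>t. (x - f y m t, t))"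
      by (intro continuous_intros fcont[OF m])
    from continuous_on_compose2[OF continuous_on_slices(1)[OF cu(1)] this]
    show "continuous_on {0..T} (\<lambda>t. u (x - f y m t) y t)" by auto
  qed

  have U_deriv: "\<forall>x y. \<forall>m\<in>P2. \<forall>t\<in>{0..<T}.
      ((\<lambda>s. u (x - f y m s) y s) has_real_derivative Ut x y m t) (at t within {0..T}) \<and>
      ((\<lambda>\<xi>. u (\<xi> - f y m t) y t) has_real_derivative Ux x y m t) (at x) \<and>
      ((\<lambda>\<xi>. Ux \<xi> y m t) has_real_derivative Uxx x y m t) (at x) \<and>
      ((\<lambda>\<eta>. Ux x \<eta> m t) has_real_derivative Uxy x y m t) (at y) \<and>
      ((\<lambda>\<eta>. u (x - f \<eta> m t) \<eta> t) has_real_derivative Uy x y m t) (at y) \<and>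
      ((\<lambda>\<eta>. Uy x \<eta> m t) has_real_derivative Uyy x y m t) (at y) \<and>
      (\<forall>z. ((\<lambda>\<zeta>. Um x y m \<zeta> t) has_real_derivative Umz x y m z t) (at z))"
  proof (intro allI ballI conjI)
    fix x y m t assume m: "m \<in> P2" and t: "t \<in> {0..<T}"
    then have t': "t \<in> {0..T}" by simp
    have "((\<lambda>s. x - f y m s) has_real_derivative - ft y m t) (at t within {0..T})"
      using DERIV_diff[OF DERIV_const df(1)[OF m t]] by simp
    from has_real_derivative_moving_argument[where S = "{0..T}" and g = "\<lambda>\<xi> s. u \<xi> y s" and
        gx = "\<lambda>\<xi> s. ux \<xi> y s", OF du(1) continuous_on_slices(1)[OF cu(2)] du(7)[OF t'] this t']
    show "((\<lambda>s. u (x - f y m s) y s) has_real_derivative Ut x y m t) (at t within {0..T})"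
      by (simp add: Ut_def)
    show "((\<lambda>\<xi>. u (\<xi> - f y m t) y t) has_real_derivative Ux x y m t) (at x)"
      using DERIV_chain2[OF du(1)[OF t'] DERIV_diff[OF DERIV_ident DERIV_const], of "f y m t" y x]
      by (simp add: Ux_def)
    show "((\<lambda>\<xi>. Ux \<xi> y m t) has_real_derivative Uxx x y m t) (at x)"
      using DERIV_chain2[OF du(3)[OF t'] DERIV_diff[OF DERIV_ident DERIV_const], of "f y m t" y x]
      by (simp add: Ux_def Uxx_def)
    show dUx: "((\<lambda>\<eta>. Ux x \<eta> m t) has_real_derivative Uxy x y m t) (at y)"
      unfolding Ux_def Uxy_def by (rule along_y[where w = ux and wx = uxx and wy = uxy, OF m t' du(3)[OF t'] du(4)[OF t'] cu(3)])
    show "((\<lambda>\<eta>. u (x - f \<eta> m t) \<eta> t) has_real_derivative Uy x y m t) (at y)"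
      unfolding Uy_def by (rule along_y[where w = u and wx = ux and wy = uy, OF m t' du(1)[OF t'] du(2)[OF t'] cu(2)])
    have "((\<lambda>\<eta>. uy (x - f \<eta> m t) \<eta> t - Ux x \<eta> m t * fy \<eta> m t) has_real_derivative
        (uyy (x - f y m t) y t - uyx (x - f y m t) y t * fy y m t)
        - (Uxy x y m t * fy y m t + fyy y m t * Ux x y m t)) (at y)"
      by (intro DERIV_diff DERIV_mult dUx df(2)[OF m t] along_y[where w = uy and wx = uyx and wy = uyy, OF m t' du(5)[OF t'] du(6)[OF t'] cu(5)])
    then show "((\<lambda>\<eta>. Uy x \<eta> m t) has_real_derivative Uyy x y m t) (at y)"
      unfolding Uy_def Ux_def[symmetric]
      by (rule DERIV_cong) (simp add: Ux_def Uxy_def Uyy_def mixed[OF t'] power2_eq_square algebra_simps)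
    show "((\<lambda>\<zeta>. Um x y m \<zeta> t) has_real_derivative Umz x y m z t) (at z)" for z
      unfolding Um_def Umz_def by (rule DERIV_cmult[OF df(3)[OF m t]])
  qed

  have U_lions: "\<forall>x y. \<forall>t\<in>{0..<T}.
      has_lions_derivative (\<lambda>m. u (x - f y m t) y t) (\<lambda>m z. Um x y m z t) \<and>
      (\<forall>z1. has_lions_derivative (\<lambda>m. Um x y m z1 t) (\<lambda>m z2. Umm x y m z1 z2 t)) \<and>
      has_lions_derivative (\<lambda>m. Ux x y m t) (\<lambda>m z. Uxm x y m z t) \<and>
      has_lions_derivative (\<lambda>m. Uy x y m t) (\<lambda>m z. Uym x y m z t)"
  proof (intro allI ballI conjI)
    fix x y t assume t: "t \<in> {0..<T}"
    then have t': "t \<in> {0..T}" by simp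
    show "has_lions_derivative (\<lambda>m. u (x - f y m t) y t) (\<lambda>m z. Um x y m z t)"
      unfolding Um_def by (rule along_m[where w = u and wx = ux, OF t' du(1)[OF t'] cu(2)])
    show Ux: "has_lions_derivative (\<lambda>m. Ux x y m t) (\<lambda>m z. Uxm x y m z t)"
      unfolding Ux_def Uxm_def by (rule along_m[where w = ux and wx = uxx, OF t' du(3)[OF t'] cu(3)])
    \<comment> \<open>\<open>Um\<close> is \<open>fm\<close> times \<open>- Ux\<close>, so the product rule is applied with the first factor negated.\<close>
    have neg: "has_lions_derivative (\<lambda>m. - Ux x y m t) (\<lambda>m z. - Uxm x y m z t)"
      by (rule has_lions_derivative_cong[OF has_lions_derivative_compose[OF Ux, of uminus "\<lambda>_. -1"]])
        (auto intro!: derivative_eq_intros)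
    show "has_lions_derivative (\<lambda>m. Um x y m z1 t) (\<lambda>m z2. Umm x y m z1 z2 t)" for z1
      by (rule has_lions_derivative_cong[OF has_lions_derivative_mult[OF neg fmm[OF t]]])
        (simp_all add: Um_def Umm_def Ux_def Uxm_def algebra_simps)
    show "has_lions_derivative (\<lambda>m. Uy x y m t) (\<lambda>m z. Uym x y m z t)"
      by (rule has_lions_derivative_cong[OF has_lions_derivative_diff[OF
              along_m[where w = uy and wx = uyx, OF t' du(5)[OF t'] cu(5)] has_lions_derivative_mult[OF Ux fym[OF t]]]])
        (simp_all add: Uy_def Uym_def Ux_def Uxm_def mixed[OF t'] algebra_simps)
  qed

  have U_eq: "\<forall>x y. \<forall>m\<in>P2. \<forall>t\<in>{0..<T}.
      single_defined \<pi> y m t (\<lambda>z. Uxm x y m z t) \<and>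
      L2_defined \<pi> y m t (\<lambda>z1 z2. Umm x y m z1 z2 t) (\<lambda>z. Umz x y m z t) \<and>
      single_defined \<pi> y m t (\<lambda>z. Um x y m z t) \<and>
      single_defined \<pi> y m t (\<lambda>z. Uym x y m z t) \<and>
      Ut x y m t + 1/2 * (\<pi> x y m t)\<^sup>2 * Uxx x y m t
        + \<pi> x y m t * (b y t * Ux x y m t + Uxy x y m t)
        + \<pi> x y m t * L1 \<pi> y m t (\<lambda>z. Uxm x y m z t)
        + L2 \<pi> y m t (\<lambda>z1 z2. Umm x y m z1 z2 t) (\<lambda>z. Umz x y m z t)
        + b y t * L3 \<pi> y m t (\<lambda>z. Um x y m z t)
        + L4 \<pi> y m t (\<lambda>z. Uym x y m z t)
        + 1/2 * Uyy x y m t + b y t * Uy x y m t = 0"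
  proof (intro allI ballI)
    fix x y m t assume m: "m \<in> P2" and t: "t \<in> {0..<T}"
    then have t': "t \<in> {0..T}" by simp
    let ?\<xi> = "x - f y m t"
    let ?i = "\<integral>z. \<pi> z y m t * fm y m z t \<partial>m"
    interpret prob_space m using m by (simp add: P2_def)
    have i: "integrable m (\<lambda>z. \<pi> z y m t * fm y m z t)"
      and p: "\<pi> x y m t - ?i = fy y m t + a ?\<xi> y t"
      using \<pi> m t' unfolding pi_relation_def by blast+
    have l4: "integrable m (\<lambda>z. \<pi> z y m t * fym y m z t)"
      using feq(2)[OF m t] by (simp add: single_defined_def)
    have Uxm: "(\<lambda>z. \<pi> z y m t * Uxm x y m z t) = (\<lambda>z. - uxx ?\<xi> y t * (\<pi> z y m t * fm y m z t))"
      and Um: "(\<lambda>z. \<pi> z y m t * Um x y m z t) = (\<lambda>z. - ux ?\<xi> y t * (\<pi> z y m t * fm y m z t))"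
      and Uym: "(\<lambda>z. \<pi> z y m t * Uym x y m z t) = (\<lambda>z. (- uxy ?\<xi> y t + uxx ?\<xi> y t * fy y m t)
        * (\<pi> z y m t * fm y m z t) - ux ?\<xi> y t * (\<pi> z y m t * fym y m z t))"
      by (simp_all add: fun_eq_iff Uxm_def Um_def Uym_def algebra_simps)
    have L1: "L1 \<pi> y m t (\<lambda>z. Uxm x y m z t) = - uxx ?\<xi> y t * ?i"
      unfolding L1_def Uxm by simp
    have L3: "L3 \<pi> y m t (\<lambda>z. Um x y m z t) = - ux ?\<xi> y t * ?i"
      unfolding L3_def Um by simp
    have L4: "L4 \<pi> y m t (\<lambda>z. Uym x y m z t) = - uxy ?\<xi> y t * ?i + uxx ?\<xi> y t * fy y m t * ?i
        - ux ?\<xi> y t * L4 \<pi> y m t (\<lambda>z. fym y m z t)"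
      unfolding L4_def Uym
        Bochner_Integration.integral_diff[OF integrable_mult_right[OF i] integrable_mult_right[OF l4]]
        integral_mult_right_zero
      by (simp add: left_diff_distrib)
    note L2 = L2_composition[OF sigma_finite_measure_axioms i feq(1)[OF m t],
        of "uxx ?\<xi> y t" "ux ?\<xi> y t"]
    have "uxx ?\<xi> y t \<noteq> 0" and hjb: "ut ?\<xi> y t - (b y t * ux ?\<xi> y t + uxy ?\<xi> y t)\<^sup>2 / (2 * uxx ?\<xi> y t)
        + 1/2 * uyy ?\<xi> y t + b y t * uy ?\<xi> y t = 0"
      using u_hjb t t' unfolding hjb_solution_def by blast+
    from master_equation_algebra[OF this feq(3)[OF m t] p[unfolded a optimal_feedback_def]]
    have "Ut x y m t + 1/2 * (\<pi> x y m t)\<^sup>2 * Uxx x y m t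
        + \<pi> x y m t * (b y t * Ux x y m t + Uxy x y m t)
        + \<pi> x y m t * L1 \<pi> y m t (\<lambda>z. Uxm x y m z t)
        + L2 \<pi> y m t (\<lambda>z1 z2. Umm x y m z1 z2 t) (\<lambda>z. Umz x y m z t)
        + b y t * L3 \<pi> y m t (\<lambda>z. Um x y m z t)
        + L4 \<pi> y m t (\<lambda>z. Uym x y m z t)
        + 1/2 * Uyy x y m t + b y t * Uy x y m t = 0"
      unfolding L1 L3 L4 Umm_def Umz_def L2(2) Ut_def Uxx_def Ux_def Uxy_def Uyy_def Uy_def .
    moreover have "single_defined \<pi> y m t (\<lambda>z. Uxm x y m z t)"
      "single_defined \<pi> y m t (\<lambda>z. Um x y m z t)" "single_defined \<pi> y m t (\<lambda>z. Uym x y m z t)"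
      unfolding single_defined_def Uxm Um Uym using i l4 by simp_all
    moreover have "L2_defined \<pi> y m t (\<lambda>z1 z2. Umm x y m z1 z2 t) (\<lambda>z. Umz x y m z t)"
      unfolding Umm_def Umz_def by (rule L2(1))
    ultimately show "single_defined \<pi> y m t (\<lambda>z. Uxm x y m z t) \<and>
      L2_defined \<pi> y m t (\<lambda>z1 z2. Umm x y m z1 z2 t) (\<lambda>z. Umz x y m z t) \<and>
      single_defined \<pi> y m t (\<lambda>z. Um x y m z t) \<and>
      single_defined \<pi> y m t (\<lambda>z. Uym x y m z t) \<and>
      Ut x y m t + 1/2 * (\<pi> x y m t)\<^sup>2 * Uxx x y m t
        + \<pi> x y m t * (b y t * Ux x y m t + Uxy x y m t)
        + \<pi> x y m t * L1 \<pi> y m t (\<lambda>z. Uxm x y m z t)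
        + L2 \<pi> y m t (\<lambda>z1 z2. Umm x y m z1 z2 t) (\<lambda>z. Umz x y m z t)
        + b y t * L3 \<pi> y m t (\<lambda>z. Um x y m z t)
        + L4 \<pi> y m t (\<lambda>z. Uym x y m z t)
        + 1/2 * Uyy x y m t + b y t * Uy x y m t = 0"
      by (intro conjI)
  qed

  have U_terminal: "\<forall>x y. \<forall>m\<in>P2. u (x - f y m T) y T = J (x - C m)"
    using u_hjb fT unfolding hjb_solution_def by simp

  show ?thesis
    unfolding master_solution_def
    by (rule conjI[OF U_cont conjI[OF _ U_terminal]], rule exI[of _ Ut], rule exI[of _ Ux],
        rule exI[of _ Uxx], rule exI[of _ Uxy], rule exI[of _ Uy], rule exI[of _ Uyy],
        rule exI[of _ Um], rule exI[of _ Umm], rule exI[of _ Umz], rule exI[of _ Uxm],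
        rule exI[of _ Uym], rule conjI[OF U_deriv conjI[OF U_lions U_eq]])
qed

end
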